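(* Let $N\in\mathbb{N}$, let $u_1<\cdots<u_N$ be even integers, and let $\xi=\sum_{j=1}^N\delta_{u_j}$. Then the noncolliding random walk $(\Xi(t),t\in\mathbb{N}_0,\mathbb{P}_\xi)$ is determinantal with the correlation kernel $\mathbb{K}_\xi$ defined in the context, in the following sense. For every $M\in\mathbb{N}$, all times $t_1<\cdots<t_M$ in $\mathbb{N}$, and all bounded functions $f_{t_1},\dots,f_{t_M}:\mathbb{Z}\to\mathbb{R}$, with $\chi_{t_m}=e^{f_{t_m}}-1$, $$\mathbb{E}_\xi\Big[\exp\Big\{\sum_{m=1}^M\int_{\mathbb{Z}} f_{t_m}(x)\,\Xi(t_m,dx)\Big\}\Big]=\mathop{\mathrm{Det}}_{(s,t)\in\{t_1,\dots,t_M\}^2,\ (x,y)\in\mathbb{Z}^2}\Big[\delta_{st}\delta_x(\{y\})+\mathbb{K}_\xi(s,x;t,y)\chi_t(y)\Big],$$ and consequently all spatio-temporal correlation functions are given by determinants: for $0\le N_m\le N$ and $\boldsymbol{x}^{(m)}_{N_m}=(x^{(m)}_1,\dots,x^{(m)}_{N_m})\in\mathbb{Z}^{N_m}$ with $x_1^{(m)}<\cdots<x_{N_m}^{(m)}$, $1\le m\le M$, $$\rho_\xi\big(t_1,\boldsymbol{x}^{(1)}_{N_1};\dots;t_M,\boldsymbol{x}^{(M)}_{N_M}\big)=\det_{\substack{1\le j\le N_m,\,1\le k\le N_n\\ 1\le m,n\le M}}\Big[\mathbb{K}_\xi\big(t_m,x^{(m)}_j;t_n,x^{(n)}_k\big)\Big]$$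 if for every $1\le m\le M$ all entries of $\boldsymbol{x}^{(m)}_{N_m}$ have the same parity as $t_m$, and $\rho_\xi(\cdots)=0$ otherwise.
   Context: $\mathbb{N}=\{1,2,\dots\}$, $\mathbb{N}_0=\{0\}\cup\mathbb{N}$, $\mathbb{Z}_{\rm e}=2\mathbb{Z}$; $\mathbf{1}(\cdot)$ is the indicator. Random walk: under $\mathrm{P}_{\boldsymbol u}$ (expectation $\mathrm{E}_{\boldsymbol u}$), $\boldsymbol S(t)=(S_1(t),\dots,S_N(t))$, $t\in\mathbb{N}_0$, has independent components, each a simple symmetric random walk on $\mathbb{Z}$, with $S_j(0)=u_j$. Its one-component transition probability is $p(t-s,y|x)=2^{-(t-s)}\binom{t-s}{[(t-s)+(y-x)]/2}$ if $t\ge s$, $|y-x|\le t-s$ and $(t-s)+(y-x)$ is even, and $0$ otherwise. Noncolliding random walk: let $\mathbb{W}_N=\{\boldsymbol x\in\mathbb{R}^N:x_1<\cdots<x_N\}$, $\tau_{\boldsymbol u}=\inf\{t\ge1:\boldsymbol S(t)\notin\mathbb{W}_N\}$, $h(\boldsymbol x)=\prod_{1\le j<k\le N}(x_k-x_j)$. For $\boldsymbol u\in\mathbb{Z}_{\rm e}^N\cap\mathbb{W}_N$ and $\xi=\sum_j\delta_{u_j}$, the noncolliding random walk $(\Xi(t),t\in\mathbb{N}_0,\mathbb{P}_\xi)$ (independent walks conditioned never to collide) is the process of point configurations (counting measures) on $\mathbb{Z}$, with expectation $\mathbb{E}_\xi$, whose law is determined by $$\mathbb{E}_\xi[F(\Xi(\cdot))]=\mathrm{E}_{\boldsymbol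 u}\Big[F\Big(\sum_{j=1}^N\delta_{S_j(\cdot)}\Big)\mathbf{1}(\tau_{\boldsymbol u}>T)\frac{h(\boldsymbol S(T))}{h(\boldsymbol u)}\Big]$$ for all $T\in\mathbb{N}$ and all bounded $F$ depending only on the configurations at times in $\{0,\dots,T\}$. Kernel: let $\widetilde\zeta(1),\widetilde\zeta(2),\dots$ be i.i.d. real random variables with the hyperbolic secant density $\frac{1}{2\cosh(\pi x/2)}$, let $\widetilde S(0)=0$, $\widetilde S(t)=\widetilde\zeta(1)+\cdots+\widetilde\zeta(t)$, with expectation $\widetilde{\mathrm{E}}$. Let $\Phi_\xi^{u_k}(z)=\prod_{1\le j\le N,\,j\ne k}\frac{z-u_j}{u_k-u_j}$, $z\in\mathbb{C}$, and $\mathcal{M}_\xi^{u_k}(t,y)=\widetilde{\mathrm{E}}[\Phi_\xi^{u_k}(y+i\widetilde S(t))]$. For $(s,x),(t,y)\in\mathbb{N}_0\times\mathbb{Z}$ with $s+x$ and $t+y$ even, $$\mathbb{K}_\xi(s,x;t,y)=\sum_{j=1}^N p(s,x|u_j)\mathcal{M}_\xi^{u_j}(t,y)-\mathbf{1}(s>t)\,p(s-t,x|y),$$ and $\mathbb{K}_\xi(s,x;t,y)=0$ otherwise. Correlation functions $\rho_\xi$ are defined by the expansion $$\mathbb{E}_\xi\Big[e^{\sum_{m}\int f_{t_m}d\Xi(t_m)}\Big]=\sum_{N_1,\dots,N_M\ge0}\ \sum_{\boldsymbol x^{(m)}_{N_m}\in\mathbb{Z}^{N_m}\cap\mathbb{W}_{N_m},\,1\le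 m\le M}\ \prod_{m=1}^M\prod_{j=1}^{N_m}\chi_{t_m}(x^{(m)}_j)\,\rho_\xi(t_1,\boldsymbol x^{(1)}_{N_1};\dots;t_M,\boldsymbol x^{(M)}_{N_M}),$$ and the Fredholm determinant $\mathrm{Det}[\delta_{st}\delta_x(\{y\})+\mathbf{K}(s,x;t,y)\chi_t(y)]$ is defined as the same sum with $\rho_\xi(\cdots)$ replaced by $\det_{1\le j\le N_m,1\le k\le N_n,1\le m,n\le M}[\mathbf{K}(t_m,x^{(m)}_j;t_n,x^{(n)}_k)]$. *)

theory Defs
  imports "HOL-Probability.Probability" "Jordan_Normal_Form.Determinant"
begin

text \<open>
  Vectors with \<open>N\<close> entries are lists of length \<open>N\<close>, so the entries \<open>x\<^sub>1, \<dots>, x\<^sub>N\<close> of the literature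
  are \<open>x ! 0, \<dots>, x ! (N - 1)\<close>.  A starting point is a list \<open>u\<close> of integers; its length is the
  number of walkers, and the initial configuration is \<open>mset u\<close>.
\<close>

definition weyl_chamber :: "nat \<Rightarrow> 'a::linorder list set" where
  "weyl_chamber n = {x. length x = n \<and> sorted_wrt (<) x}"

definition vandermonde :: "int list \<Rightarrow> real" where
  "vandermonde x = (\<Prod>k<length x. \<Prod>j<k. real_of_int (x ! k - x ! j))"


subsection \<open>Independent simple symmetric random walks\<close>

text \<open>The coordinate \<open>(j, i)\<close> is the \<open>i\<close>-th step of the \<open>j\<close>-th walker; steps with \<open>i = 0\<close> are
  not used.\<close>

definition walk_space :: "nat \<Rightarrow> (nat \<times> nat \<Rightarrow> int) measure" where
  "walk_space N = Pi\<^sub>M ({..<N} \<times> UNIV) (\<lambda>_. measure_pmf (pmf_of_set {- 1, 1}))"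

definition walk :: "int list \<Rightarrow> nat \<Rightarrow> (nat \<times> nat \<Rightarrow> int) \<Rightarrow> int list" where
  "walk u t \<omega> = map (\<lambda>j. u ! j + (\<Sum>i=1..t. \<omega> (j, i))) [0..<length u]"

text \<open>The infimum is taken in \<^typ>\<open>enat\<close>, where the infimum of the empty set is \<open>\<infinity>\<close>.\<close>

definition collision_time :: "int list \<Rightarrow> (nat \<times> nat \<Rightarrow> int) \<Rightarrow> enat" where
  "collision_time u \<omega> = Inf {enat t |t. t \<ge> 1 \<and> walk u t \<omega> \<notin> weyl_chamber (length u)}"

text \<open>The transition probability \<open>p(n, y | x)\<close>, with the time difference \<open>n\<close> as argument.\<close>

definition srw_prob :: "nat \<Rightarrow> int \<Rightarrow> int \<Rightarrow> real" where
  "srw_prob n y x =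
     (if \<bar>y - x\<bar> \<le> int n \<and> even (int n + (y - x))
      then real (n choose nat ((int n + (y - x)) div 2)) / 2 ^ n else 0)"


subsection \<open>The noncolliding random walk\<close>

text \<open>
  A (finite) point configuration on the integers is a multiset; \<open>config_measure\<close> is the
  counting measure it stands for.  There are only countably many such configurations, and they carry
  the discrete \<open>\<sigma>\<close>-algebra; in particular every function of the configurations at finitely many
  times is measurable.
\<close>

definition config_measure :: "int multiset \<Rightarrow> int measure" where
  "config_measure X = point_measure UNIV (\<lambda>x. ennreal (real (count X x)))"

definition depends_up_to :: "nat \<Rightarrow> ((nat \<Rightarrow> int multiset) \<Rightarrow> real) \<Rightarrow> bool" where
  "depends_up_to T F \<longleftrightarrow> (\<forall>X Y. (\<forall>t\<le>T. X t = Y t) \<longrightarrow> F X = F Y)"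

definition noncolliding_walk ::
    "int list \<Rightarrow> 'a measure \<Rightarrow> (nat \<Rightarrow> 'a \<Rightarrow> int multiset) \<Rightarrow> bool" where
  "noncolliding_walk u P \<Xi> \<longleftrightarrow>
     prob_space P \<and>
     (\<forall>t. \<Xi> t \<in> measurable P (count_space UNIV)) \<and>
     (\<forall>T\<ge>1. \<forall>F. bounded (range F) \<and> depends_up_to T F \<longrightarrow>
        (\<integral>\<omega>. F (\<lambda>t. \<Xi> t \<omega>) \<partial>P) =
        (\<integral>\<omega>. F (\<lambda>t. mset (walk u t \<omega>)) * of_bool (collision_time u \<omega> > enat T) *
              (vandermonde (walk u T \<omega>) / vandermonde u) \<partial>walk_space (length u)))"


subsection \<open>The correlation kernel\<close>

definition sech_measure :: "real measure" where
  "sech_measure = density lborel (\<lambda>x. ennreal (1 / (2 * cosh (pi * x / 2))))"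

definition sech_space :: "(nat \<Rightarrow> real) measure" where
  "sech_space = Pi\<^sub>M UNIV (\<lambda>_. sech_measure)"

definition sech_walk :: "nat \<Rightarrow> (nat \<Rightarrow> real) \<Rightarrow> real" where
  "sech_walk t \<zeta> = (\<Sum>i=1..t. \<zeta> i)"

text \<open>In \<open>Phi u k\<close> and \<open>mart u k\<close> the point \<open>u ! k\<close> is referred to by its index \<open>k\<close>.\<close>

definition Phi :: "int list \<Rightarrow> nat \<Rightarrow> complex \<Rightarrow> complex" where
  "Phi u k z = (\<Prod>j\<in>{..<length u} - {k}. (z - of_int (u ! j)) / of_int (u ! k - u ! j))"

definition mart :: "int list \<Rightarrow> nat \<Rightarrow> nat \<Rightarrow> int \<Rightarrow> complex" where
  "mart u k t y = (\<integral>\<zeta>. Phi u k (of_int y + \<i> * of_real (sech_walk t \<zeta>)) \<partial>sech_space)"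

definition corr_kernel :: "int list \<Rightarrow> nat \<times> int \<Rightarrow> nat \<times> int \<Rightarrow> complex" where
  "corr_kernel u = (\<lambda>(s, x) (t, y).
     if even (int s + x) \<and> even (int t + y)
     then (\<Sum>j<length u. of_real (srw_prob s x (u ! j)) * mart u j t y)
          - (if s > t then of_real (srw_prob (s - t) x y) else 0)
     else 0)"


subsection \<open>Correlation functions and Fredholm determinants\<close>

text \<open>Finite sequences of times \<open>1 \<le> t\<^sub>1 < \<dots> < t\<^sub>M\<close> with \<open>M \<ge> 1\<close>.\<close>

definition time_points :: "nat list \<Rightarrow> bool" where
  "time_points ts \<longleftrightarrow> ts \<noteq> [] \<and> sorted_wrt (<) ts \<and> (\<forall>t\<in>set ts. t \<ge> 1)"

text \<open>
  All families of strictly increasing tuples of integers, one tuple of arbitrary length \<open>N\<^sub>m \<ge> 0\<close>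
  for each of \<open>M\<close> times.  As the length is determined by the tuple, a sum over this set is the
  sum over all \<open>N\<^sub>1, \<dots>, N\<^sub>M\<close> and all tuples of these lengths.
\<close>

definition config_families :: "nat \<Rightarrow> int list list set" where
  "config_families M = {xs. length xs = M \<and> (\<forall>m<M. \<exists>n. xs ! m \<in> weyl_chamber n)}"

definition weight :: "nat list \<Rightarrow> (nat \<Rightarrow> int \<Rightarrow> real) \<Rightarrow> int list list \<Rightarrow> real" where
  "weight ts g xs = (\<Prod>m<length ts. \<Prod>j<length (xs ! m). g (ts ! m) (xs ! m ! j))"

definition is_correlation_function ::
    "'a measure \<Rightarrow> (nat \<Rightarrow> 'a \<Rightarrow> int multiset) \<Rightarrow> (nat list \<Rightarrow> int list list \<Rightarrow> real) \<Rightarrow> bool" where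
  "is_correlation_function P \<Xi> \<rho> \<longleftrightarrow>
     (\<forall>ts f. time_points ts \<and> (\<forall>t\<in>set ts. bounded (range (f t))) \<longrightarrow>
        ((\<lambda>xs. weight ts (\<lambda>t x. exp (f t x) - 1) xs * \<rho> ts xs) has_sum
          (\<integral>\<omega>. exp (\<Sum>t\<leftarrow>ts. \<integral>x. f t x \<partial>config_measure (\<Xi> t \<omega>)) \<partial>P))
        (config_families (length ts)))"

text \<open>The rows and columns of the block determinant are indexed by the space-time points
  \<open>(t\<^sub>m, x\<^sub>j\<^sup>m)\<close>, listed block by block.\<close>

definition space_time_points :: "nat list \<Rightarrow> int list list \<Rightarrow> (nat \<times> int) list" where
  "space_time_points ts xs = concat (map2 (\<lambda>t x. map (Pair t) x) ts xs)"

definition kernel_det ::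
    "(nat \<times> int \<Rightarrow> nat \<times> int \<Rightarrow> complex) \<Rightarrow> nat list \<Rightarrow> int list list \<Rightarrow> complex" where
  "kernel_det K ts xs =
     (let ps = space_time_points ts xs; n = length ps
      in Determinant.det (Matrix.mat n n (\<lambda>(i, j). K (ps ! i) (ps ! j))))"

definition fredholm_term ::
    "(nat \<times> int \<Rightarrow> nat \<times> int \<Rightarrow> complex) \<Rightarrow> nat list \<Rightarrow> (nat \<Rightarrow> int \<Rightarrow> real) \<Rightarrow> int list list \<Rightarrow> complex"
  where "fredholm_term K ts g xs = of_real (weight ts g xs) * kernel_det K ts xs"

definition fredholm_det ::
    "(nat \<times> int \<Rightarrow> nat \<times> int \<Rightarrow> complex) \<Rightarrow> nat list \<Rightarrow> (nat \<Rightarrow> int \<Rightarrow> real) \<Rightarrow> complex" where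
  "fredholm_det K ts g = infsum (fredholm_term K ts g) (config_families (length ts))"

end

theory Submission
  imports Defs "HOL-Complex_Analysis.Cauchy_Integral_Theorem" "HOL-Real_Asymp.Real_Asymp"
begin

text \<open>
  By the definition of the process the generating functional is an expectation over independent
  walks, killed at the first collision and weighted with \<open>h(S(T)) / h(u)\<close>.  This ratio is the
  determinant of the \<open>M\<^sub>k(T, S\<^sub>j(T))\<close>: the polynomials \<open>M\<^sub>k(T, \<cdot>)\<close> are, up to a unitriangular
  change of basis, a fixed combination of monomials, and \<open>M\<^sub>k(0, u\<^sub>j) = \<delta>\<^sub>j\<^sub>k\<close>.  Hence the backward
  recursion preserves determinants of one-particle functions.  These vanish when two walkers meet,
  so the killing has no effect, and the expectation equals \<open>det (Z\<^sub>k(0, u\<^sub>j))\<close> with the one-particle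
  backward functions \<open>Z\<^sub>k\<close>.  As \<open>M\<^sub>k\<close> is a space-time martingale, expanding the product of the
  \<open>1 + \<chi>\<close> at the first selected time gives \<open>Z = M + L \<chi> Z\<close> with \<open>L\<close> strictly triangular
  in time, and Sylvester's identity turns \<open>det (Z\<^sub>k(0, u\<^sub>j))\<close> into \<open>det (1 + \<chi> K)\<close> on the finite
  light cone of \<open>u\<close>; its expansion in principal minors is the Fredholm expansion.
  The martingale property says that \<open>(1 + i \<zeta>)\<^sup>n + (- 1 + i \<zeta>)\<^sup>n\<close> has mean \<open>0\<close> for \<open>n \<ge> 1\<close>: up to a
  factor \<open>i\<close> this mean is the difference of the integrals of \<open>w\<^sup>n / (2 sin (\<pi> w / 2))\<close> along
  \<open>Re w = 1\<close> and \<open>Re w = - 1\<close>, and the integrand is holomorphic between these lines.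
\<close>


subsection \<open>The hyperbolic secant distribution\<close>

text \<open>Since \<open>2 * cosh y\<close> dominates \<open>exp |y|\<close> and
  \<open>pi / 2\<close> is at least \<open>1\<close>, the density has an exponential tail, which
  controls all moments.\<close>

lemma sech_density_le: "1 / (2 * cosh (pi * x / 2)) \<le> exp (- \<bar>x\<bar>)" for x :: real
proof -
  have "exp \<bar>x\<bar> \<le> exp \<bar>pi * x / 2\<bar>"
    using pi_ge_two mult_right_mono[of 2 pi "\<bar>x\<bar>"] by (simp add: abs_mult)
  also have "\<dots> \<le> 2 * cosh (pi * x / 2)"
    unfolding cosh_field_def by (cases "x \<ge> 0") (simp_all add: abs_mult)
  finally have "inverse (2 * cosh (pi * x / 2)) \<le> inverse (exp \<bar>x\<bar>)"
    by (intro le_imp_inverse_le) auto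
  then show ?thesis
    by (simp only: exp_minus divide_inverse mult_1)
qed

text \<open>One term of the exponential series is at most the whole series.\<close>

lemma power_le_fact_exp: "y ^ n \<le> fact n * exp y" if "0 \<le> y" for y :: real
proof -
  have "y ^ n /\<^sub>R fact n \<le> (\<Sum>k. y ^ k /\<^sub>R fact k)"
    using that by (intro order.trans[OF _ sum_le_suminf[of _ "{n}"]] summable_exp_generic) auto
  then have "y ^ n /\<^sub>R fact n \<le> exp y"
    by (simp add: exp_def)
  then show ?thesis
    by (simp add: field_simps)
qed

lemma sets_sech_measure [simp, measurable_cong]: "sets sech_measure = sets borel"
  by (simp add: sech_measure_def)

lemma space_sech_measure [simp]: "space sech_measure = UNIV"
  by (simp add: sech_measure_def)

lemma integrable_inverse_1_plus_square_lborel: "integrable lborel (\<lambda>x::real. inverse (1 + x\<^sup>2))"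
  using integrable_inverse_1_plus_square by (simp add: set_integrable_def einterval_def)

lemma borel_measurable_cosh [measurable]: "cosh \<in> borel_measurable (borel :: real measure)"
  by (intro borel_measurable_continuous_onI continuous_intros)

text \<open>The exponential tail absorbs \<open>|x| ^ n * (1 + x ^ 2)\<close>, so a multiple of the
  integrable function \<open>1 / (1 + x ^ 2)\<close> dominates the integrand.\<close>

lemma integrable_sech_power: "integrable sech_measure (\<lambda>x. x ^ n)"
  unfolding sech_measure_def
proof (subst integrable_density)
  show "integrable lborel (\<lambda>x::real. (1 / (2 * cosh (pi * x / 2))) *\<^sub>R x ^ n)"
  proof (rule Bochner_Integration.integrable_bound)
    show "integrable lborel (\<lambda>x::real. (fact n + fact (n + 2)) * inverse (1 + x\<^sup>2))"
      using integrable_inverse_1_plus_square_lborel by simp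
    show "AE x in lborel. norm ((1 / (2 * cosh (pi * x / 2))) *\<^sub>R x ^ n)
        \<le> norm ((fact n + fact (n + 2)) * inverse (1 + x\<^sup>2))"
    proof (rule AE_I2)
      fix x :: real
      have "\<bar>x\<bar> ^ n * (1 + x\<^sup>2) = \<bar>x\<bar> ^ n + \<bar>x\<bar> ^ (n + 2)"
        by (simp add: power_add algebra_simps power2_eq_square)
      also have "\<dots> \<le> (fact n + fact (n + 2)) * exp \<bar>x\<bar>"
        using power_le_fact_exp[of "\<bar>x\<bar>" n] power_le_fact_exp[of "\<bar>x\<bar>" "n + 2"]
        by (simp only: distrib_right) simp
      finally have "\<bar>x\<bar> ^ n * exp (- \<bar>x\<bar>) \<le> (fact n + fact (n + 2)) * inverse (1 + x\<^sup>2)"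
        by (simp add: exp_minus field_simps add_pos_nonneg)
      moreover have "1 / (2 * cosh (pi * x / 2)) * \<bar>x\<bar> ^ n \<le> exp (- \<bar>x\<bar>) * \<bar>x\<bar> ^ n"
        by (intro mult_right_mono sech_density_le) auto
      ultimately show "norm ((1 / (2 * cosh (pi * x / 2))) *\<^sub>R x ^ n)
          \<le> norm ((fact n + fact (n + 2)) * inverse (1 + x\<^sup>2))"
        by (simp add: abs_mult power_abs add_nonneg_nonneg mult_ac)
    qed
  qed auto
qed auto

lemma prob_space_sech_measure: "prob_space sech_measure"
proof
  let ?f = "\<lambda>x::real. 1 / (2 * cosh (pi * x / 2))"
  \<comment> \<open>The density has this elementary primitive; it runs from \<open>0\<close> to
    \<open>1\<close>, so the total mass is \<open>1\<close>.\<close>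
  let ?F = "\<lambda>x::real. 2 / pi * arctan (exp (pi * x / 2))"
  have F: "DERIV ?F x :> ?f x" for x
  proof -
    have "0 < 1 + exp (pi * x / 2) * exp (pi * x / 2)"
      by (simp add: add_pos_nonneg)
    then show ?thesis
      by (auto intro!: derivative_eq_intros simp: cosh_field_def exp_minus power2_eq_square divide_simps)
  qed
  have lim1: "(?F \<longlongrightarrow> 0) at_bot" by real_asymp
  have lim2: "(?F \<longlongrightarrow> 1) at_top" by real_asymp
  have cont: "isCont ?f x" for x
    by (intro continuous_intros) (auto simp: cosh_real_pos less_imp_neq[symmetric])
  have "set_integrable lborel (einterval (-\<infinity>) \<infinity>) ?f" "(LBINT x=-\<infinity>..\<infinity>. ?f x) = 1 - 0"
    by (rule interval_integral_FTC_nonneg[where F = ?F]; 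
        use F lim1 lim2 cont in \<open>simp add: ereal_tendsto_simps\<close>)+
  then have "integrable lborel ?f" "integral\<^sup>L lborel ?f = 1"
    by (simp_all add: set_integrable_def einterval_def interval_integral_eq_integral interval_lebesgue_integral_def set_lebesgue_integral_def)
  then have "(\<integral>\<^sup>+x. ennreal (?f x) \<partial>lborel) = 1"
    by (subst nn_integral_eq_integral) auto
  then show "emeasure sech_measure (space sech_measure) = 1"
    by (simp add: sech_measure_def emeasure_density)
qed

section \<open>The strip between the lines Re w = -1 and Re w = 1\<close>

lemma sin_half_pi_shift:
  fixes x :: real
  shows "sin (of_real pi * (1 + \<i> * of_real x) / 2) = (of_real (cosh (pi * x / 2)) :: complex)"
    and "sin (of_real pi * (- 1 + \<i> * of_real x) / 2) = (- of_real (cosh (pi * x / 2)) :: complex)"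
  by (auto simp: complex_eq_iff Re_sin Im_sin cosh_field_def field_simps)

text \<open>The squared modulus of \<open>sin z\<close> exceeds the square of the left side by the
  square of \<open>sin (Re z)\<close>. The bound makes horizontal segments far from the real axis
  negligible.\<close>

lemma norm_sin_ge_sinh: "\<bar>sinh (Im z)\<bar> \<le> norm (sin z)"
proof -
  have "(sinh (Im z))\<^sup>2 \<le> (sinh (Im z))\<^sup>2 + (sin (Re z))\<^sup>2" by simp
  also have "\<dots> = (sinh (Im z))\<^sup>2 * ((sin (Re z))\<^sup>2 + (cos (Re z))\<^sup>2) + (sin (Re z))\<^sup>2"
    by simp
  also have "\<dots> = (sin (Re z) * cosh (Im z))\<^sup>2 + (cos (Re z) * sinh (Im z))\<^sup>2"
    unfolding power_mult_distrib cosh_square_eq by (simp only: distrib_left mult_1_right mult.commute add_ac)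
  also have "\<dots> = (norm (sin z))\<^sup>2"
    by (simp add: cmod_power2 Re_sin Im_sin cosh_field_def sinh_field_def)
  finally show ?thesis
    by (simp add: abs_le_square_iff[symmetric])
qed

text \<open>The zeros are the even integers, and \<open>0\<close> is the only one in this
  strip.\<close>

lemma sin_half_pi_neq_0:
  assumes "\<bar>Re w\<bar> < 2" "w \<noteq> 0"
  shows "sin (of_real pi * w / 2) \<noteq> 0"
proof
  assume "sin (of_real pi * w / 2) = 0"
  then obtain n :: int where "of_real pi * w / 2 = of_real (of_int n * pi)"
    unfolding sin_eq_0 by auto
  then have w: "w = of_int (2 * n)"
    by (simp add: field_simps)
  with assms have "\<bar>real_of_int n\<bar> < 1" "n \<noteq> 0" by auto
  then show False by linarith
qed

text \<open>The factor \<open>w ^ k\<close> with \<open>k \<ge> 1\<close> cancels the only zero of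
  the denominator in the strip, which is simple. The strip is wider than the region between the two
  lines, so that these lie in its interior.\<close>

lemma sech_moment_primitive:
  assumes "k \<ge> 1"
  obtains F Q where "\<And>w. w \<noteq> 0 \<Longrightarrow> F w = w ^ k / (2 * sin (of_real pi * w / 2))"
    and "\<And>w. \<bar>Re w\<bar> < 2 \<Longrightarrow> (Q has_field_derivative F w) (at w)"
    and "continuous_on {w. \<bar>Re w\<bar> < 2} F"
proof -
  let ?S = "{w::complex. \<bar>Re w\<bar> < 2}"
  \<comment> \<open>The value \<open>1 / pi\<close> is the limit at \<open>0\<close>, as
    \<open>sin (pi w / 2)\<close> behaves like \<open>pi w / 2\<close> there.\<close>
  define G where "G w = (if w = 0 then 1 / of_real pi else w / (2 * sin (of_real pi * w / 2)))"
    for w :: complex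
  define F where "F w = w ^ (k - 1) * G w" for w
  have S: "?S = {w. Re w < 2} \<inter> {w. Re w > - 2}" by auto
  have openS: "open ?S"
    unfolding S by (intro open_Int open_halfspace_Re_lt open_halfspace_Re_gt)
  have convS: "convex ?S"
    unfolding S by (intro convex_Int convex_halfspace_Re_lt convex_halfspace_Re_gt)
  have diffG: "G field_differentiable (at w)" if "w \<in> ?S - {0}" for w
  proof -
    have "(\<lambda>w. w / (2 * sin (of_real pi * w / 2))) holomorphic_on (?S - {0})"
      by (auto intro!: holomorphic_intros simp: sin_half_pi_neq_0)
    then have "(\<lambda>w. w / (2 * sin (of_real pi * w / 2))) field_differentiable (at w)"
      using that openS by (auto elim!: holomorphic_on_imp_differentiable_at intro!: open_Diff)
    moreover have "\<forall>\<^sub>F w' in nhds w. w' / (2 * sin (of_real pi * w' / 2)) = G w'"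
      using that eventually_nhds_in_open[of "- {0}" w]
      by (auto simp: G_def elim!: eventually_mono)
    ultimately show ?thesis
      unfolding field_differentiable_def by (metis DERIV_cong_ev)
  qed
  have "((\<lambda>w. sin (of_real pi * w / 2)) has_field_derivative of_real pi / 2) (at (0::complex))"
    by (auto intro!: derivative_eq_intros)
  then have lim: "(\<lambda>w::complex. sin (of_real pi * w / 2) / w) \<midarrow>0\<rightarrow> of_real pi / 2"
    by (simp add: DERIV_def)
  have "(\<lambda>w::complex. 1 / (2 * (sin (of_real pi * w / 2) / w))) \<midarrow>0\<rightarrow> 1 / (2 * (of_real pi / 2))"
    by (intro tendsto_divide[OF tendsto_const] tendsto_mult[OF tendsto_const] lim) auto
  then have "G \<midarrow>0\<rightarrow> 1 / (2 * (of_real pi / 2))"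
    by (rule Lim_transform_eventually) (auto simp: G_def eventually_at_filter)
  then have "isCont G 0"
    by (simp add: isCont_def G_def)
  then have contG: "continuous_on ?S G"
    using diffG by (intro continuous_at_imp_continuous_on ballI)
      (metis DiffI field_differentiable_imp_continuous_at insertE empty_iff)
  have contF: "continuous_on ?S F"
    unfolding F_def by (intro continuous_intros contG)
  have diffF: "F field_differentiable (at w)" if "w \<in> interior ?S - {0}" for w
    using that interior_subset[of ?S] unfolding F_def
    by (intro field_differentiable_mult diffG field_differentiable_power field_differentiable_ident) auto
  \<comment> \<open>The existence of a primitive on a convex set tolerates finitely many points of
    mere continuity; here the only one is \<open>0\<close>.\<close>
  obtain Q where Q: "\<And>w. w \<in> ?S \<Longrightarrow> (Q has_field_derivative F w) (at w within ?S)"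
    using holomorphic_convex_primitive[OF convS _ contF diffF] by blast
  show ?thesis
  proof (rule that[of F Q])
    show "F w = w ^ k / (2 * sin (of_real pi * w / 2))" if "w \<noteq> 0" for w
      using that assms by (cases k) (auto simp: F_def G_def)
    show "(Q has_field_derivative F w) (at w)" if "\<bar>Re w\<bar> < 2" for w
      using Q[of w] at_within_open[of w, OF _ openS] that by simp
  qed (rule contF)
qed

text \<open>The difference is the integral of \<open>F\<close> over a horizontal segment of length
  \<open>2\<close>, on which \<open>F\<close> is bounded by a polynomial divided by an exponentially
  growing \<open>sinh\<close>. This closes the contour at both ends.\<close>

lemma primitive_strip_difference_tendsto_0:
  fixes F Q :: "complex \<Rightarrow> complex"
  assumes F: "\<And>w. w \<noteq> 0 \<Longrightarrow> F w = w ^ k / (2 * sin (of_real pi * w / 2))"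
    and Q: "\<And>w. \<bar>Re w\<bar> < 2 \<Longrightarrow> (Q has_field_derivative F w) (at w)"
    and L: "L = at_top \<or> L = at_bot"
  shows "((\<lambda>x. Q (1 + \<i> * of_real x) - Q (- 1 + \<i> * of_real x)) \<longlongrightarrow> 0) L"
proof (rule Lim_null_comparison)
  let ?B = "\<lambda>x::real. (1 + \<bar>x\<bar>) ^ k / (2 * \<bar>sinh (pi * x / 2)\<bar>) * 2"
  have "norm (Q (1 + \<i> * of_real x) - Q (- 1 + \<i> * of_real x)) \<le> ?B x" if "x \<noteq> 0" for x
  proof -
    let ?l = "closed_segment (- 1 + \<i> * of_real x) (1 + \<i> * of_real x)"
    have Im: "Im w = x" "\<bar>Re w\<bar> \<le> 1" if w_in: "w \<in> ?l" for w
    proof -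
      obtain u where u: "0 \<le> u" "u \<le> 1"
        and w: "w = (1 - u) *\<^sub>R (- 1 + \<i> * of_real x) + u *\<^sub>R (1 + \<i> * of_real x)"
        using w_in unfolding in_segment(1) by blast
      have "Re w = 2 * u - 1" "Im w = x" unfolding w by (simp_all add: algebra_simps)
      with u show "Im w = x" "\<bar>Re w\<bar> \<le> 1" by auto
    qed
    have "norm (Q (1 + \<i> * of_real x) - Q (- 1 + \<i> * of_real x))
        \<le> (1 + \<bar>x\<bar>) ^ k / (2 * \<bar>sinh (pi * x / 2)\<bar>) * norm ((1 + \<i> * of_real x) - (- 1 + \<i> * of_real x))"
    proof (rule field_differentiable_bound[where S = ?l and f' = F])
      fix w assume w: "w \<in> ?l"
      from Im[OF w] show "(Q has_field_derivative F w) (at w within ?l)"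
        by (intro DERIV_subset[OF Q]) auto
      have "w \<noteq> 0" using Im[OF w] \<open>x \<noteq> 0\<close> by auto
      have "norm w \<le> 1 + \<bar>x\<bar>" using cmod_le[of w] Im[OF w] by simp
      moreover have "\<bar>sinh (pi * x / 2)\<bar> \<le> norm (sin (of_real pi * w / 2))"
        using norm_sin_ge_sinh[of "of_real pi * w / 2"] Im[OF w] by simp
      moreover have "0 < \<bar>sinh (pi * x / 2)\<bar>"
        using \<open>x \<noteq> 0\<close> by simp
      ultimately show "norm (F w) \<le> (1 + \<bar>x\<bar>) ^ k / (2 * \<bar>sinh (pi * x / 2)\<bar>)"
        unfolding F[OF \<open>w \<noteq> 0\<close>] norm_divide norm_mult norm_power
        by (intro frac_le power_mono mult_mono) auto
    qed auto
    also have "norm ((1 + \<i> * of_real x) - (- 1 + \<i> * of_real x)) = 2" by simp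
    finally show ?thesis .
  qed
  moreover have "\<forall>\<^sub>F x in L. x \<noteq> (0 :: real)"
    using L eventually_gt_at_top[of 0] eventually_gt_at_bot[of 0] by (auto elim!: eventually_mono)
  ultimately show "\<forall>\<^sub>F x in L. norm (Q (1 + \<i> * of_real x) - Q (- 1 + \<i> * of_real x)) \<le> ?B x"
    by (auto elim!: eventually_mono simp del: norm_minus_commute)
  have top: "((\<lambda>x. (1 + x) ^ k / (2 * sinh (pi * x / 2)) * 2) \<longlongrightarrow> 0) (at_top :: real filter)"
    by real_asymp
  have top': "(?B \<longlongrightarrow> 0) at_top"
    by (rule Lim_transform_eventually[OF top], rule eventually_mono[OF eventually_gt_at_top[of 0]]) auto
  moreover have "(?B \<longlongrightarrow> 0) at_bot"
    unfolding filterlim_at_bot_mirror using top' by simp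
  ultimately show "(?B \<longlongrightarrow> 0) L"
    using L by auto
qed

lemma integrable_sech_shift_power:
  "integrable sech_measure (\<lambda>x. (c + \<i> * of_real x) ^ k)"
proof -
  have "integrable sech_measure (\<lambda>x. of_nat (k choose j) * c ^ j * (\<i> ^ (k - j) * of_real (x ^ (k - j))))" for j
    by (intro integrable_mult_right integrable_of_real integrable_sech_power)
  then show ?thesis
    unfolding binomial_ring power_mult_distrib of_real_power[symmetric]
    by (intro Bochner_Integration.integrable_sum) auto
qed

text \<open>For \<open>k \<ge> 1\<close> the difference \<open>?P\<close> of the primitive on the
  two lines is, up to a factor, an antiderivative of the weighted integrand, and it vanishes at both
  infinities.\<close>

lemma sech_moment:
  "(\<integral>x. (1 + \<i> * of_real x) ^ k + (- 1 + \<i> * of_real x) ^ k \<partial>sech_measure) = (if k = 0 then 2 else 0)"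
proof (cases "k = 0")
  case True
  interpret prob_space sech_measure by (rule prob_space_sech_measure)
  show ?thesis using True prob_space by simp
next
  case False
  then obtain F Q where F: "\<And>w. w \<noteq> 0 \<Longrightarrow> F w = w ^ k / (2 * sin (of_real pi * w / 2))"
    and Q: "\<And>w. \<bar>Re w\<bar> < 2 \<Longrightarrow> (Q has_field_derivative F w) (at w)"
    and cont: "continuous_on {w. \<bar>Re w\<bar> < 2} F"
    using sech_moment_primitive[of k] by (metis One_nat_def Suc_le_eq neq0_conv)
  let ?d = "\<lambda>x::real. 1 / (2 * cosh (pi * x / 2))"
  let ?f = "\<lambda>x::real. (1 + \<i> * of_real x) ^ k + (- 1 + \<i> * of_real x) ^ k"
  let ?H = "\<lambda>x::real. \<i> * (F (1 + \<i> * of_real x) - F (- 1 + \<i> * of_real x))"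
  let ?P = "\<lambda>x::real. Q (1 + \<i> * of_real x) - Q (- 1 + \<i> * of_real x)"
  \<comment> \<open>The opposite signs of \<open>sin (pi w / 2)\<close> on the two lines turn the
    sum of the powers into a difference of values of \<open>F\<close>.\<close>
  have H: "?H x = \<i> * (?d x *\<^sub>R ?f x)" for x
  proof -
    have "1 + \<i> * of_real x \<noteq> 0" "- 1 + \<i> * of_real x \<noteq> 0"
      by (auto simp: complex_eq_iff)
    then have "F (1 + \<i> * of_real x) = ?d x *\<^sub>R (1 + \<i> * of_real x) ^ k"
      and "F (- 1 + \<i> * of_real x) = - (?d x *\<^sub>R (- 1 + \<i> * of_real x) ^ k)"
      using F[of "1 + \<i> * of_real x"] F[of "- 1 + \<i> * of_real x"]
      unfolding sin_half_pi_shift by (simp_all add: scaleR_conv_of_real)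
    then show ?thesis
      by (simp only: scaleR_add_right diff_minus_eq_add)
  qed
  have int: "integrable sech_measure ?f"
    by (intro Bochner_Integration.integrable_add integrable_sech_shift_power)
  then have "integrable lborel (\<lambda>x. ?d x *\<^sub>R ?f x)"
    unfolding sech_measure_def by (subst (asm) integrable_density) auto
  then have intH: "integrable lborel ?H"
    unfolding H by (rule integrable_mult_right)
  have "(LBINT x=-\<infinity>..\<infinity>. ?H x) = 0 - 0"
  proof (rule interval_integral_FTC_integrable[where F = ?P])
    have at: "\<bar>Re (1 + \<i> * of_real x)\<bar> < 2" "\<bar>Re (- 1 + \<i> * of_real x)\<bar> < 2" for x by auto
    have 1: "((\<lambda>x. Q (c + \<i> * of_real x)) has_vector_derivative \<i> * F (c + \<i> * of_real x)) (at x)"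
      if "\<bar>Re c\<bar> < 2" for c x
    proof -
      have "((\<lambda>x. c + \<i> * of_real x) has_vector_derivative \<i>) (at x)"
        by (auto intro!: derivative_eq_intros simp: has_vector_derivative_def scaleR_conv_of_real)
      then show ?thesis
        using field_vector_diff_chain_at[where g = Q and f = "\<lambda>x. c + \<i> * of_real x"] Q[of "c + \<i> * of_real x"] that
        by (simp add: o_def)
    qed
    show "(?P has_vector_derivative ?H x) (at x)" for x
      using has_vector_derivative_diff[OF 1[of 1 x] 1[of "- 1" x]] by (simp add: algebra_simps)
    have "continuous_on UNIV (\<lambda>x. F (c + \<i> * of_real x))" if "\<bar>Re c\<bar> < 2" for c
      by (rule continuous_on_compose2[OF cont]) (use that in \<open>auto intro!: continuous_intros\<close>)
    from this[of 1] this[of "- 1"] show "isCont ?H x" for x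
      by (auto intro!: continuous_intros simp: continuous_on_eq_continuous_at)
    show "set_integrable lborel (einterval (-\<infinity>) \<infinity>) ?H"
      using intH by (simp add: set_integrable_def einterval_def)
    show "((?P \<circ> real_of_ereal) \<longlongrightarrow> 0) (at_right (-\<infinity>))" "((?P \<circ> real_of_ereal) \<longlongrightarrow> 0) (at_left \<infinity>)"
      using primitive_strip_difference_tendsto_0[OF F Q] by (auto simp: ereal_tendsto_simps)
  qed simp
  then have "(\<integral>x. ?H x \<partial>lborel) = 0"
    by (simp add: interval_lebesgue_integral_def set_lebesgue_integral_def einterval_def)
  then have "(\<integral>x. ?d x *\<^sub>R ?f x \<partial>lborel) = 0"
    unfolding H integral_mult_right_zero by simp
  moreover have "(\<integral>x. ?f x \<partial>sech_measure) = (\<integral>x. ?d x *\<^sub>R ?f x \<partial>lborel)"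
    unfolding sech_measure_def by (rule integral_density) auto
  ultimately show ?thesis using False by simp
qed


subsection \<open>The martingale polynomials\<close>

interpretation sech: prob_space sech_measure
  by (rule prob_space_sech_measure)

lemma prob_space_sech_space: "prob_space sech_space"
  unfolding sech_space_def by (intro prob_space_PiM prob_space_sech_measure)

interpretation sech_space: prob_space sech_space
  by (rule prob_space_sech_space)

lemma measurable_sech_component [measurable]: "(\<lambda>\<zeta>. \<zeta> i) \<in> borel_measurable sech_space"
  unfolding sech_space_def
  using measurable_component_singleton[of i UNIV "\<lambda>_. sech_measure"]
  by (simp add: measurable_cong_sets[OF refl sets_sech_measure])

lemma measurable_sech_walk [measurable]: "sech_walk t \<in> borel_measurable sech_space"
  unfolding sech_walk_def by measurable

lemma sech_walk_0 [simp]: "sech_walk 0 \<zeta> = 0"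
  by (simp add: sech_walk_def)

lemma sech_walk_Suc: "sech_walk (Suc t) \<zeta> = sech_walk t \<zeta> + \<zeta> (Suc t)"
  by (simp add: sech_walk_def)

lemma distr_sech_component: "distr sech_space borel (\<lambda>\<zeta>. \<zeta> i) = sech_measure"
proof -
  have "distr sech_space sech_measure (\<lambda>\<zeta>. \<zeta> i) = sech_measure"
    unfolding sech_space_def by (rule distr_PiM_component) (auto intro: prob_space_sech_measure)
  then show ?thesis
    by (simp cong: distr_cong)
qed

text \<open>The joint map of the coordinates is the identity, so their joint law is the product
  measure, which is the product of their laws.\<close>

lemma indep_vars_PiM_coordinates:
  assumes "\<And>i. i \<in> I \<Longrightarrow> prob_space (M i)" "I \<noteq> {}"
  shows "prob_space.indep_vars (Pi\<^sub>M I M) M (\<lambda>i \<omega>. \<omega> i) I"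
proof -
  interpret prob_space "Pi\<^sub>M I M"
    using assms(1) by (rule prob_space_PiM)
  have "distr (Pi\<^sub>M I M) (Pi\<^sub>M I M) (\<lambda>\<omega>. \<lambda>i\<in>I. \<omega> i) = distr (Pi\<^sub>M I M) (Pi\<^sub>M I M) (\<lambda>\<omega>. \<omega>)"
    by (intro distr_cong refl) (auto simp: space_PiM PiE_def extensional_restrict)
  also have "\<dots> = (\<Pi>\<^sub>M i\<in>I. distr (Pi\<^sub>M I M) (M i) (\<lambda>\<omega>. \<omega> i))"
    unfolding distr_id by (intro PiM_cong refl distr_PiM_component[symmetric] assms)
  finally show ?thesis
    using assms(2) by (subst indep_vars_iff_distr_eq_PiM') auto
qed

lemma indep_sech_walk: "sech_space.indep_var borel (\<lambda>\<zeta>. \<zeta> (Suc t)) borel (sech_walk t)"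
proof -
  have "sech_space.indep_vars (\<lambda>_. sech_measure) (\<lambda>i \<zeta>. \<zeta> i) UNIV"
    unfolding sech_space_def by (rule indep_vars_PiM_coordinates) (auto intro: prob_space_sech_measure)
  then have "sech_space.indep_vars (\<lambda>_. sech_measure) (\<lambda>i \<zeta>. \<zeta> i) (insert (Suc t) {1..t})"
    by (rule sech_space.indep_vars_subset) auto
  then have "sech_space.indep_vars (\<lambda>_. borel) (\<lambda>i \<zeta>. \<zeta> i) (insert (Suc t) {1..t})"
    by (rule sech_space.indep_vars_compose2) (simp add: measurable_ident_sets)
  then show ?thesis
    unfolding sech_walk_def by (intro sech_space.indep_vars_sum) auto
qed

lemma indep_sech_walk_power:
  "sech_space.indep_var borel (\<lambda>\<zeta>. (d + \<i> * of_real (\<zeta> (Suc t))) ^ m :: complex)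
     borel (\<lambda>\<zeta>. (c + \<i> * of_real (sech_walk t \<zeta>)) ^ n :: complex)"
  using sech_space.indep_var_compose[OF indep_sech_walk, 
      of "\<lambda>x. (d + \<i> * of_real x) ^ m" borel "\<lambda>x. (c + \<i> * of_real x) ^ n" borel]
  by (simp add: o_def)

lemma integrable_sech_component_power:
  "integrable sech_space (\<lambda>\<zeta>. (d + \<i> * of_real (\<zeta> i)) ^ m :: complex)"
proof -
  have "integrable (distr sech_space borel (\<lambda>\<zeta>. \<zeta> i)) (\<lambda>x. (d + \<i> * of_real x) ^ m)"
    unfolding distr_sech_component by (rule integrable_sech_shift_power)
  then show ?thesis
    by (subst (asm) integrable_distr_eq) auto
qed

lemma integral_sech_component:
  fixes f :: "real \<Rightarrow> complex"
  assumes "f \<in> borel_measurable borel"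
  shows "(\<integral>\<zeta>. f (\<zeta> i) \<partial>sech_space) = (\<integral>x. f x \<partial>sech_measure)"
  using integral_distr[of "\<lambda>\<zeta>. \<zeta> i" sech_space borel f] assms by (simp add: distr_sech_component)

lemma binomial_shift:
  fixes d z :: complex
  shows "(z + d + \<i> * of_real (a + b)) ^ n =
    (\<Sum>k\<le>n. of_nat (n choose k) * ((d + \<i> * of_real b) ^ k * (z + \<i> * of_real a) ^ (n - k)))"
proof -
  have "z + d + \<i> * of_real (a + b) = (d + \<i> * of_real b) + (z + \<i> * of_real a)"
    by (simp add: algebra_simps)
  then show ?thesis
    by (simp only: binomial_ring mult.assoc)
qed

lemma integrable_sech_walk_power:
  "integrable sech_space (\<lambda>\<zeta>. (c + \<i> * of_real (sech_walk t \<zeta>)) ^ n :: complex)"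
proof (induction t arbitrary: c n)
  case 0
  then show ?case by simp
next
  case (Suc t)
  \<comment> \<open>The summand \<open>0\<close> makes this an instance of
    \<open>binomial_shift\<close> with \<open>d = 0\<close>; each term is a product of independent
    integrable factors.\<close>
  have "integrable sech_space (\<lambda>\<zeta>. \<Sum>k\<le>n. of_nat (n choose k) *
      ((0 + \<i> * of_real (\<zeta> (Suc t))) ^ k * (c + \<i> * of_real (sech_walk t \<zeta>)) ^ (n - k)))"
    by (intro Bochner_Integration.integrable_sum integrable_mult_right
        sech_space.indep_var_integrable indep_sech_walk_power Suc integrable_sech_component_power)
  then show ?case
    unfolding sech_walk_Suc by (simp only: binomial_shift[symmetric] add_0_right)
qed

text \<open>The images of the monomials \<open>z ^ n\<close> under averaging over the imaginary
  walk: for each \<open>t\<close> an Appell sequence of monic polynomials.\<close>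

definition sech_moment_poly :: "nat \<Rightarrow> nat \<Rightarrow> complex \<Rightarrow> complex" where
  "sech_moment_poly t n z = (\<integral>\<zeta>. (z + \<i> * of_real (sech_walk t \<zeta>)) ^ n \<partial>sech_space)"

text \<open>Binomial expansion separates the last increment, and independence factors the
  expectation.\<close>

lemma sech_moment_poly_step:
  "sech_moment_poly (Suc t) n (z + d) =
     (\<Sum>k\<le>n. of_nat (n choose k) * (\<integral>x. (d + \<i> * of_real x) ^ k \<partial>sech_measure) * sech_moment_poly t (n - k) z)"
proof -
  have comp: "(\<integral>\<zeta>. (d + \<i> * of_real (\<zeta> (Suc t))) ^ k \<partial>sech_space) = (\<integral>x. (d + \<i> * of_real x) ^ k \<partial>sech_measure)" for k
    by (rule integral_sech_component[of "\<lambda>x. (d + \<i> * of_real x) ^ k"]) simp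
  have "sech_moment_poly (Suc t) n (z + d) = (\<integral>\<zeta>. (\<Sum>k\<le>n. of_nat (n choose k) *
      ((d + \<i> * of_real (\<zeta> (Suc t))) ^ k * (z + \<i> * of_real (sech_walk t \<zeta>)) ^ (n - k))) \<partial>sech_space)"
    by (simp only: sech_moment_poly_def sech_walk_Suc binomial_shift)
  also have "\<dots> = (\<Sum>k\<le>n. of_nat (n choose k) * ((\<integral>\<zeta>. (d + \<i> * of_real (\<zeta> (Suc t))) ^ k \<partial>sech_space) *
      sech_moment_poly t (n - k) z))"
    unfolding sech_moment_poly_def
    by (subst Bochner_Integration.integral_sum)
      (auto simp: sech_space.indep_var_lebesgue_integral[OF indep_sech_walk_power
          integrable_sech_component_power integrable_sech_walk_power]
        intro!: integrable_mult_right sech_space.indep_var_integrable indep_sech_walk_power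
          integrable_sech_component_power integrable_sech_walk_power)
  finally show ?thesis
    by (simp only: comp mult.assoc)
qed

text \<open>By \<open>sech_moment\<close>, adding the expansions for \<open>d = 1\<close> and
  \<open>d = - 1\<close> leaves only the term \<open>k = 0\<close>. So these polynomials are
  space-time martingales for the simple random walk.\<close>

lemma sech_moment_poly_harmonic:
  "sech_moment_poly (Suc t) n (z + 1) + sech_moment_poly (Suc t) n (z - 1) = 2 * sech_moment_poly t n z"
proof -
  have "(\<integral>x. (1 + \<i> * of_real x) ^ k \<partial>sech_measure) + (\<integral>x. (- 1 + \<i> * of_real x) ^ k \<partial>sech_measure)
      = (if k = 0 then 2 else 0)" for k
    unfolding sech_moment[symmetric]
    by (intro Bochner_Integration.integral_add[symmetric] integrable_sech_shift_power)
  then have "sech_moment_poly (Suc t) n (z + 1) + sech_moment_poly (Suc t) n (z + - 1)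
     = (\<Sum>k\<le>n. of_nat (n choose k) * (if k = 0 then 2 else 0) * sech_moment_poly t (n - k) z)"
    unfolding sech_moment_poly_step sum.distrib[symmetric] distrib_right[symmetric] distrib_left[symmetric]
    by simp
  also have "\<dots> = (\<Sum>k\<le>n. if k = 0 then 2 * sech_moment_poly t n z else 0)"
    by (intro sum.cong) auto
  also have "\<dots> = 2 * sech_moment_poly t n z"
    by simp
  finally show ?thesis by simp
qed

text \<open>The coefficients do not involve \<open>z\<close> and the top one is \<open>1\<close>:
  for each \<open>t\<close> this is a unitriangular change of basis from the monomials.\<close>

lemma sech_moment_poly_expand:
  "sech_moment_poly t n z = (\<Sum>k\<le>n. z ^ k * (of_nat (n choose k) * sech_moment_poly t (n - k) 0))"
proof -
  have "sech_moment_poly t n z = (\<integral>\<zeta>. (\<Sum>k\<le>n. (of_nat (n choose k) * z ^ k) *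
      (0 + \<i> * of_real (sech_walk t \<zeta>)) ^ (n - k)) \<partial>sech_space)"
    by (simp add: sech_moment_poly_def binomial_ring)
  also have "\<dots> = (\<Sum>k\<le>n. (of_nat (n choose k) * z ^ k) * sech_moment_poly t (n - k) 0)"
    unfolding sech_moment_poly_def
    by (subst Bochner_Integration.integral_sum) (auto intro!: integrable_mult_right integrable_sech_walk_power simp del: add_0)
  finally show ?thesis
    by (simp add: mult_ac)
qed

lemma sech_moment_poly_0 [simp]: "sech_moment_poly t 0 z = 1"
  by (simp add: sech_moment_poly_def sech_space.prob_space)

section \<open>Lagrange polynomials and their martingale transforms\<close>

definition Phi_poly :: "int list \<Rightarrow> nat \<Rightarrow> complex poly" where
  "Phi_poly u k = (\<Prod>j\<in>{..<length u} - {k}.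
     Polynomial.smult (1 / of_int (u ! k - u ! j)) [:- of_int (u ! j), 1:])"

lemma poly_Phi_poly: "poly (Phi_poly u k) z = Phi u k z"
  by (simp add: Phi_poly_def Phi_def poly_prod diff_divide_distrib)

lemma degree_Phi_poly:
  assumes "k < length u"
  shows "degree (Phi_poly u k) < length u"
proof -
  have linear: "degree (Polynomial.smult a [:b, 1:]) \<le> 1" for a b :: complex
    by (rule order.trans[OF degree_smult_le]) simp
  have "degree (Phi_poly u k) \<le> (\<Sum>j\<in>{..<length u} - {k}. 1)"
    unfolding Phi_poly_def
    by (rule order.trans[OF degree_prod_sum_le]) (simp, unfold o_def, intro sum_mono linear)
  also have "\<dots> = length u - 1" using assms by simp
  finally show ?thesis using assms by linarith
qed

text \<open>The polynomial coefficients depend on neither \<open>t\<close> nor \<open>y\<close>, so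
  the matrix of all \<open>mart\<close> values factors through a fixed coefficient matrix.\<close>

lemma mart_eq_sum:
  assumes "k < length u"
  shows "mart u k t y = (\<Sum>n<length u. sech_moment_poly t n (of_int y) * Polynomial.coeff (Phi_poly u k) n)"
proof -
  have "Phi u k z = (\<Sum>n<length u. Polynomial.coeff (Phi_poly u k) n * z ^ n)" for z
    unfolding poly_Phi_poly[symmetric] poly_altdef using degree_Phi_poly[OF assms]
    by (intro sum.mono_neutral_left) (auto simp: coeff_eq_0)
  then show ?thesis
    unfolding mart_def sech_moment_poly_def
    by (simp add: Bochner_Integration.integral_sum integrable_sech_walk_power mult.commute)
qed

lemma mart_harmonic:
  assumes "k < length u"
  shows "mart u k (Suc t) (y + 1) + mart u k (Suc t) (y - 1) = 2 * mart u k t y"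
  unfolding mart_eq_sum[OF assms] sum.distrib[symmetric] sum_distrib_left distrib_right[symmetric]
  by (simp add: sech_moment_poly_harmonic flip: mult.assoc)

lemma mart_0: "mart u k 0 y = Phi u k (of_int y)"
  by (simp add: mart_def sech_space.prob_space)

lemma Phi_node:
  assumes "k < length u" "j < length u" "distinct u"
  shows "Phi u k (of_int (u ! j)) = (if j = k then 1 else 0)"
  using assms by (auto simp: Phi_def nth_eq_iff_index_eq intro!: prod.neutral)


subsection \<open>Determinants\<close>

text \<open>A determinant indexed by a finite set instead of an initial segment of the naturals, so
  that principal minors are its values on subsets.\<close>

definition sdet :: "'a set \<Rightarrow> ('a \<Rightarrow> 'a \<Rightarrow> 'b::comm_ring_1) \<Rightarrow> 'b" where
  "sdet S A = (\<Sum>p | p permutes S. of_int (sign p) * (\<Prod>x\<in>S. A x (p x)))"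

text \<open>An enumeration of the set carries permutations of the indices to permutations of the set
  with the same sign.\<close>

lemma det_eq_sdet:
  fixes A :: "'a \<Rightarrow> 'a \<Rightarrow> 'b::comm_ring_1"
  assumes "distinct qs"
  shows "Determinant.det (Matrix.mat (length qs) (length qs) (\<lambda>(i, j). A (qs ! i) (qs ! j))) = sdet (set qs) A"
proof -
  let ?n = "length qs"
  let ?f = "\<lambda>i. qs ! i"
  let ?g = "inv_into {0..<?n} ?f"
  have bij: "bij_betw ?f {0..<?n} (set qs)"
    using assms by (intro bij_betw_nth) auto
  have inv: "?g (?f i) = i" if "i < ?n" for i
    using bij that by (simp add: bij_betw_inv_into_left)
  have inv': "?f (?g x) = x" if "x \<in> set qs" for x
    using bij that by (simp add: bij_betw_inv_into_right)
  have "(\<Sum>p | p permutes {0..<?n}. signof p * (\<Prod>i = 0..<?n. A (qs ! i) (qs ! p i))) =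
      (\<Sum>p | p permutes set qs. of_int (sign p) * (\<Prod>x\<in>set qs. A x (p x)))"
  proof (rule sum.reindex_bij_witness[where j = "map_permutation {0..<?n} ?f" and i = "map_permutation (set qs) ?g"])
    fix p assume "p \<in> {p. p permutes {0..<?n}}"
    then have p: "p permutes {0..<?n}" by simp
    show "map_permutation (set qs) ?g (map_permutation {0..<?n} ?f p) = p"
      by (rule map_permutation_compose_inv[OF bij p]) (simp add: inv)
    show "map_permutation {0..<?n} ?f p \<in> {p. p permutes set qs}"
      using map_permutation_permutes[OF bij p] by simp
    have "map_permutation {0..<?n} ?f p (?f i) = ?f (p i)" if "i < ?n" for i
      using that inv by (auto simp: map_permutation_def restrict_id_def)
    then have "(\<Prod>x\<in>set qs. A x (map_permutation {0..<?n} ?f p x)) = (\<Prod>i = 0..<?n. A (?f i) (?f (p i)))"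
      by (subst prod.reindex_bij_betw[OF bij, symmetric]) simp
    moreover have "sign (map_permutation {0..<?n} ?f p) = sign p"
      using bij p by (intro sign_map_permutation) (auto simp: bij_betw_def)
    ultimately show "of_int (sign (map_permutation {0..<?n} ?f p)) *
        (\<Prod>x\<in>set qs. A x (map_permutation {0..<?n} ?f p x)) =
        signof p * (\<Prod>i = 0..<?n. A (qs ! i) (qs ! p i))"
      by simp
  next
    fix p assume "p \<in> {p. p permutes set qs}"
    then have p: "p permutes set qs" by simp
    show "map_permutation {0..<?n} ?f (map_permutation (set qs) ?g p) = p"
      by (rule map_permutation_compose_inv[OF bij_betw_inv_into[OF bij] p]) (simp add: inv')
    show "map_permutation (set qs) ?g p \<in> {p. p permutes {0..<?n}}"
      using map_permutation_permutes[OF bij_betw_inv_into[OF bij] p] by simp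
  qed
  moreover have "(\<Prod>i = 0..<?n. Matrix.mat ?n ?n (\<lambda>(i, j). A (qs ! i) (qs ! j)) $$ (i, p i))
      = (\<Prod>i = 0..<?n. A (qs ! i) (qs ! p i))" if "p permutes {0..<?n}" for p
    using permutes_in_image[OF that] by (intro prod.cong) auto
  ultimately show ?thesis
    by (simp add: det_def'[where n = ?n] sdet_def)
qed

lemma sdet_row_0:
  assumes "finite S" "x \<in> S" "\<And>y. y \<in> S \<Longrightarrow> A x y = 0"
  shows "sdet S A = 0"
  unfolding sdet_def
proof (intro sum.neutral ballI)
  fix p assume "p \<in> {p. p permutes S}"
  then have "A x (p x) = 0"
    using assms permutes_in_image[of p S x] by auto
  with assms have "(\<Prod>x\<in>S. A x (p x)) = 0"
    by (intro prod_zero) auto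
  then show "of_int (sign p) * (\<Prod>x\<in>S. A x (p x)) = 0" by simp
qed

lemma sdet_scale_rows: "sdet S (\<lambda>x y. c x * A x y) = (\<Prod>x\<in>S. c x) * sdet S A"
  unfolding sdet_def prod.distrib sum_distrib_left by (simp add: mult_ac)

text \<open>Multiplying out the row products chooses the set \<open>Y\<close> of rows where
  \<open>A\<close> is taken. The identity entries force the permutation to fix the remaining rows,
  so it permutes \<open>Y\<close>.\<close>

lemma sdet_id_plus:
  assumes "finite X"
  shows "sdet X (\<lambda>x y. of_bool (x = y) + A x y) = (\<Sum>Y\<in>Pow X. sdet Y A)"
proof -
  have "sdet X (\<lambda>x y. of_bool (x = y) + A x y) =
      (\<Sum>p | p permutes X. \<Sum>Y\<in>Pow X. of_int (sign p) * ((\<Prod>x\<in>Y. A x (p x)) * (\<Prod>x\<in>X - Y. of_bool (x = p x))))"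
    unfolding sdet_def by (subst add.commute, subst prod_add[OF assms]) (simp add: sum_distrib_left)
  also have "\<dots> = (\<Sum>Y\<in>Pow X. \<Sum>p | p permutes X. of_int (sign p) * ((\<Prod>x\<in>Y. A x (p x)) * (\<Prod>x\<in>X - Y. of_bool (x = p x))))"
    by (rule sum.swap)
  also have "\<dots> = (\<Sum>Y\<in>Pow X. sdet Y A)"
  proof (intro sum.cong refl)
    fix Y assume "Y \<in> Pow X"
    then have "Y \<subseteq> X" by simp
    have fixed: "(\<Prod>x\<in>X - Y. of_bool (x = p x)) = (of_bool (\<forall>x\<in>X - Y. p x = x) :: 'b)" for p
      using assms by (auto simp: of_bool_def intro!: prod.neutral prod_zero) (metis DiffI)
    have "p permutes Y" if "p permutes X" "\<forall>x\<in>X - Y. p x = x" for p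
      using that by (auto intro: permutes_superset)
    then have "{p. p permutes X \<and> (\<forall>x\<in>X - Y. p x = x)} = {p. p permutes Y}"
      using \<open>Y \<subseteq> X\<close> by (auto intro: permutes_subset simp: permutes_not_in)
    moreover have "finite {p. p permutes X}"
      using assms by (rule finite_permutations)
    then have "(\<Sum>p | p permutes X. of_int (sign p) * ((\<Prod>x\<in>Y. A x (p x)) * (\<Prod>x\<in>X - Y. of_bool (x = p x)))) =
        (\<Sum>p | p permutes X \<and> (\<forall>x\<in>X - Y. p x = x). of_int (sign p) * (\<Prod>x\<in>Y. A x (p x)))"
      unfolding fixed by (intro sum.mono_neutral_cong_right) auto
    ultimately show "(\<Sum>p | p permutes X. of_int (sign p) * ((\<Prod>x\<in>Y. A x (p x)) * (\<Prod>x\<in>X - Y. of_bool (x = p x)))) = sdet Y A"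
      by (simp add: sdet_def)
  qed
  finally show ?thesis .
qed

section \<open>Vandermonde determinants and the ratio \<open>h(x) / h(u)\<close>\<close>

lemma det_unitriangular_combination:
  fixes f :: "nat \<Rightarrow> 'a::idom \<Rightarrow> 'a"
  assumes "\<And>j z. f j z = (\<Sum>m\<le>j. z ^ m * c j m)" "\<And>j. c j j = 1"
  shows "Determinant.det (Matrix.mat n n (\<lambda>(i, j). f j (x i))) = Determinant.det (Matrix.mat n n (\<lambda>(i, j). x i ^ j))"
proof -
  let ?V = "Matrix.mat n n (\<lambda>(i, j). x i ^ j)"
  let ?C = "Matrix.mat n n (\<lambda>(m, j). if m \<le> j then c j m else 0)"
  have "Matrix.mat n n (\<lambda>(i, j). f j (x i)) = ?V * ?C"
  proof (rule eq_matI)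
    fix i j assume "i < dim_row (?V * ?C)" "j < dim_col (?V * ?C)"
    then have "i < n" "j < n" by auto
    then have "(?V * ?C) $$ (i, j) = (\<Sum>m\<in>{0..<n}. x i ^ m * (if m \<le> j then c j m else 0))"
      by (simp add: scalar_prod_def)
    also have "\<dots> = f j (x i)"
      using \<open>j < n\<close> unfolding assms(1) by (intro sum.mono_neutral_cong_right) auto
    finally show "Matrix.mat n n (\<lambda>(i, j). f j (x i)) $$ (i, j) = (?V * ?C) $$ (i, j)"
      using \<open>i < n\<close> \<open>j < n\<close> by simp
  qed auto
  moreover have "Determinant.det ?C = prod_list (diag_mat ?C)"
    by (rule det_upper_triangular[of _ n]) auto
  then have "Determinant.det ?C = 1"
    using assms(2) by (simp add: prod_list_diag_prod)
  ultimately show ?thesis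
    by (simp add: det_mult[of _ n])
qed

text \<open>Evaluated in the Newton basis, the Vandermonde matrix is triangular.\<close>

lemma det_vandermonde:
  fixes x :: "nat \<Rightarrow> 'a::idom"
  shows "Determinant.det (Matrix.mat n n (\<lambda>(i, j). x i ^ j)) = (\<Prod>k<n. \<Prod>j<k. x k - x j)"
proof -
  define q where "q j = (\<Prod>l<j. [:- x l, 1:])" for j
  have lead: "lead_coeff (q j) = 1" for j
    by (simp add: q_def lead_coeff_prod)
  have deg: "degree (q j) = j" for j
    by (simp add: q_def degree_prod_eq_sum_degree)
  have "Determinant.det (Matrix.mat n n (\<lambda>(i, j). x i ^ j)) = Determinant.det (Matrix.mat n n (\<lambda>(i, j). poly (q j) (x i)))"
  proof (rule det_unitriangular_combination[symmetric])
    show "poly (q j) z = (\<Sum>m\<le>j. z ^ m * Polynomial.coeff (q j) m)" for j z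
      by (simp add: poly_altdef deg mult.commute)
    show "Polynomial.coeff (q j) j = 1" for j
      using lead[of j] by (simp add: deg)
  qed
  also have "\<dots> = prod_list (diag_mat (Matrix.mat n n (\<lambda>(i, j). poly (q j) (x i))))"
    by (rule det_lower_triangular[of n]) (auto simp: q_def poly_prod intro!: prod_zero)
  also have "\<dots> = (\<Prod>k<n. \<Prod>j<k. x k - x j)"
    by (simp add: prod_list_diag_prod q_def poly_prod lessThan_atLeast0)
  finally show ?thesis .
qed

lemma vandermonde_neq_0: "u \<in> weyl_chamber N \<Longrightarrow> vandermonde u \<noteq> 0"
  by (force simp: vandermonde_def weyl_chamber_def sorted_wrt_iff_nth_less)

text \<open>The matrix is that of the moment polynomials, with the Vandermonde determinant of
  \<open>x\<close> at every time \<open>t\<close>, multiplied by the coefficient matrix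
  \<open>?C\<close>.\<close>

lemma det_mart:
  assumes u: "u \<in> weyl_chamber N" and x: "length x = N"
  shows "Determinant.det (Matrix.mat N N (\<lambda>(i, k). mart u k t (x ! i))) =
    of_real (vandermonde x / vandermonde u)"
proof -
  have [simp]: "length u = N" and "distinct u"
    using u by (auto simp: weyl_chamber_def strict_sorted_iff)
  let ?C = "Matrix.mat N N (\<lambda>(n, k). Polynomial.coeff (Phi_poly u k) n)"
  have *: "Determinant.det (Matrix.mat N N (\<lambda>(i, k). mart u k t (x ! i))) = of_real (vandermonde x) * Determinant.det ?C"
    if [simp]: "length x = N" for x t
  proof -
    let ?M = "Matrix.mat N N (\<lambda>(i, n). sech_moment_poly t n (of_int (x ! i)))"
    have "Matrix.mat N N (\<lambda>(i, k). mart u k t (x ! i)) = ?M * ?C"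
      by (rule eq_matI) (auto simp: mart_eq_sum scalar_prod_def lessThan_atLeast0)
    moreover have "Determinant.det ?M = Determinant.det (Matrix.mat N N (\<lambda>(i, n). (of_int (x ! i) :: complex) ^ n))"
      by (rule det_unitriangular_combination[OF sech_moment_poly_expand]) simp
    moreover have "\<dots> = of_real (vandermonde x)"
      unfolding det_vandermonde by (simp add: vandermonde_def)
    ultimately show ?thesis
      by (simp add: det_mult[of _ N])
  qed
  \<comment> \<open>Time \<open>0\<close> and the nodes \<open>u\<close> themselves give the
    identity matrix, which fixes the determinant of \<open>?C\<close>.\<close>
  have "Matrix.mat N N (\<lambda>(i, k). mart u k 0 (u ! i)) = 1\<^sub>m N"
    by (rule eq_matI) (auto simp: mart_0 Phi_node \<open>distinct u\<close>)
  with *[of u 0] have "of_real (vandermonde u) * Determinant.det ?C = 1"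
    by simp
  then have "Determinant.det ?C = 1 / of_real (vandermonde u)"
    using vandermonde_neq_0[OF u] by (simp add: field_simps)
  then show ?thesis
    using *[OF x] by simp
qed

text \<open>Both sides are the determinant of the block matrix \<open>[[U, - U Z], [C, 1]]\<close>.\<close>

lemma sylvester_det:
  fixes U Z C :: "'a::idom mat"
  assumes U: "U \<in> carrier_mat n n" and Z: "Z \<in> carrier_mat n m" and C: "C \<in> carrier_mat m n"
    and det_U: "Determinant.det U = 1"
  shows "Determinant.det (1\<^sub>m m + C * Z) = Determinant.det (U + U * Z * C)"
proof -
  let ?I = "1\<^sub>m m :: 'a mat" and ?In = "1\<^sub>m n :: 'a mat"
  let ?B = "U * Z"
  let ?M = "four_block_mat U (- ?B) C ?I"
  have B: "?B \<in> carrier_mat n m" by (rule mult_carrier_mat[OF U Z])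
  \<comment> \<open>This unipotent right factor clears the upper right block of \<open>?M\<close>;
    since \<open>det U = 1\<close>, what is left is \<open>det (1 + C Z)\<close>.\<close>
  have "?M * four_block_mat ?In Z (0\<^sub>m m n) ?I =
      four_block_mat (U * ?In + (- ?B) * 0\<^sub>m m n) (U * Z + (- ?B) * ?I) (C * ?In + ?I * 0\<^sub>m m n) (C * Z + ?I * ?I)"
    by (rule mult_four_block_mat[of _ n n _ m _ m]) (use U Z C B in auto)
  also have "\<dots> = four_block_mat U (0\<^sub>m n m) C (1\<^sub>m m + C * Z)"
    using U Z C B
    by (intro arg_cong4[where f = four_block_mat]) (auto intro!: eq_matI simp: scalar_prod_def)
  finally have "Determinant.det ?M * Determinant.det (four_block_mat ?In Z (0\<^sub>m m n) ?I) = Determinant.det (four_block_mat U (0\<^sub>m n m) C (1\<^sub>m m + C * Z))"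
    using U Z C B by (subst det_mult[of _ "n + m", symmetric]) auto
  then have 1: "Determinant.det ?M = Determinant.det (1\<^sub>m m + C * Z)"
    using U Z C B det_U
    by (simp add: det_four_block_mat_lower_left_zero[of _ n _ m] det_four_block_mat_upper_right_zero[of _ n _ m])
  \<comment> \<open>This one clears the lower left block instead and leaves
    \<open>det (U + U Z C)\<close>.\<close>
  have "?M * four_block_mat ?In (0\<^sub>m n m) (- C) ?I =
      four_block_mat (U * ?In + (- ?B) * (- C)) (U * 0\<^sub>m n m + (- ?B) * ?I) (C * ?In + ?I * (- C)) (C * 0\<^sub>m n m + ?I * ?I)"
    by (rule mult_four_block_mat[of _ n n _ m _ m]) (use U Z C B in auto)
  also have "\<dots> = four_block_mat (U + ?B * C) (- ?B) (0\<^sub>m m n) ?I"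
    using U Z C B
    by (intro arg_cong4[where f = four_block_mat]) (auto intro!: eq_matI simp: scalar_prod_def)
  finally have "Determinant.det ?M * Determinant.det (four_block_mat ?In (0\<^sub>m n m) (- C) ?I) = Determinant.det (four_block_mat (U + ?B * C) (- ?B) (0\<^sub>m m n) ?I)"
    using U Z C B by (subst det_mult[of _ "n + m", symmetric]) auto
  then have "Determinant.det ?M = Determinant.det (U + ?B * C)"
    using U Z C B
    by (simp add: det_four_block_mat_lower_left_zero[of _ n _ m] det_four_block_mat_upper_right_zero[of _ n _ m])
  with 1 show ?thesis by simp
qed


subsection \<open>Backward functions of the random walk\<close>

lemma srw_prob_0: "srw_prob 0 y x = of_bool (x = y)"
  by (auto simp: srw_prob_def)

lemma srw_prob_neq_0D:
  assumes "srw_prob n y x \<noteq> 0"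
  shows "\<bar>y - x\<bar> \<le> int n" "even (int n + (y - x))"
  using assms by (auto simp: srw_prob_def split: if_splits)

text \<open>Conditioning on the first step; for the binomial coefficients this is Pascal's
  rule.\<close>

lemma srw_prob_Suc: "srw_prob (Suc n) y x = (srw_prob n y (x + 1) + srw_prob n y (x - 1)) / 2"
proof -
  \<comment> \<open>Above the range the binomial coefficient is \<open>0\<close> by itself. Below it
    \<open>nat\<close> would truncate to \<open>0\<close> and give the coefficient \<open>1\<close>,
    so the lower bound stays.\<close>
  have drop_upper: "srw_prob n y x = (if 0 \<le> int n + (y - x) \<and> even (int n + (y - x))
      then real (n choose nat ((int n + (y - x)) div 2)) / 2 ^ n else 0)" for n x
  proof (cases "even (int n + (y - x))")
    case True
    then obtain k where k: "int n + (y - x) = 2 * k" by (rule evenE)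
    then have "y - x = 2 * k - int n" by simp
    then have abs: "\<bar>y - x\<bar> \<le> int n \<longleftrightarrow> 0 \<le> k \<and> k \<le> int n" by auto
    have "n choose nat k = 0" if "\<not> k \<le> int n"
      using that by (intro binomial_eq_0) auto
    then show ?thesis
      unfolding srw_prob_def abs k by auto
  next
    case False
    then show ?thesis by (simp only: srw_prob_def simp_thms if_False)
  qed
  show ?thesis
  proof (cases "even (int (Suc n) + (y - x)) \<and> 0 \<le> int (Suc n) + (y - x)")
    case True
    from conjunct1[OF True] obtain k where k: "int (Suc n) + (y - x) = 2 * k" by (rule evenE)
    with True have "k \<ge> 0" by simp
    then obtain m where m: "k = int m" by (rule nonneg_int_cases)
    have up: "int n + (y - (x + 1)) = 2 * (k - 1)" and down: "int n + (y - (x - 1)) = 2 * k"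
      using k by auto
    show ?thesis
      unfolding drop_upper k up down m by (cases m) (simp_all add: field_simps nat_add_distrib)
  next
    case False
    then have "\<not> (0 \<le> int n + (y - (x + 1)) \<and> even (int n + (y - (x + 1))))"
      "\<not> (0 \<le> int n + (y - (x - 1)) \<and> even (int n + (y - (x - 1))))"
      by (auto simp: algebra_simps)
    with False show ?thesis
      unfolding drop_upper by auto
  qed
qed

text \<open>With \<open>n\<close> steps to go before time \<open>T\<close>: the expectation, for a walk at \<open>x\<close> at time
  \<open>T - n\<close>, of \<open>M T\<close> at its final position times the product of the later \<open>g\<close>.\<close>

primrec backward :: "(nat \<Rightarrow> int \<Rightarrow> complex) \<Rightarrow> nat \<Rightarrow> (nat \<Rightarrow> int \<Rightarrow> complex) \<Rightarrow> nat \<Rightarrow> int \<Rightarrow> complex" where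
  "backward g T M 0 x = M T x"
| "backward g T M (Suc n) x =
     (g (T - n) (x + 1) * backward g T M n (x + 1) + g (T - n) (x - 1) * backward g T M n (x - 1)) / 2"

text \<open>Sum over the first time \<open>s\<close> at which \<open>c\<close> rather than
  \<open>1\<close> is chosen from a factor \<open>1 + c\<close>. Up to \<open>s\<close> the walk
  moves freely, which gives the transition probability; if \<open>c\<close> is never chosen,
  harmonicity gives back \<open>M\<close>. The range is open at \<open>T - n\<close> because
  \<open>g\<close> acts only after a step.\<close>

lemma backward_expansion:
  fixes c :: "nat \<Rightarrow> int \<Rightarrow> complex"
  assumes harmonic: "\<And>t x. M t x = (M (Suc t) (x + 1) + M (Suc t) (x - 1)) / 2"
    and fin: "\<And>t. finite (X t)"
    and step: "\<And>t x. x \<in> X t \<Longrightarrow> x + 1 \<in> X (Suc t) \<and> x - 1 \<in> X (Suc t)"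
    and g: "\<And>t x. g t x = 1 + c t x"
    and "n \<le> T" "x \<in> X (T - n)"
  shows "backward g T M n x = M (T - n) x + (\<Sum>s\<in>{T - n<..T}. \<Sum>y\<in>X s.
    of_real (srw_prob (s - (T - n)) y x) * (c s y * backward g T M (T - s) y))"
  using assms(5,6)
proof (induction n arbitrary: x)
  case 0
  then show ?case by simp
next
  case (Suc n)
  define t where "t = T - Suc n"
  have t: "T - n = Suc t" "T - Suc n = t" "T - Suc t = n" using Suc.prems by (auto simp: t_def)
  let ?Z = "\<lambda>s y. c s y * backward g T M (T - s) y"
  let ?p = "\<lambda>n y x. complex_of_real (srw_prob n y x)"
  have x: "x \<in> X t" "x + 1 \<in> X (Suc t)" "x - 1 \<in> X (Suc t)"
    using Suc.prems step[of x t] by (auto simp: t)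
  have IH: "backward g T M n z = M (Suc t) z + (\<Sum>s\<in>{Suc t<..T}. \<Sum>y\<in>X s. ?p (s - Suc t) y z * ?Z s y)"
    if "z \<in> X (Suc t)" for z
    using Suc.IH[of z] Suc.prems that unfolding t by simp
  have p_Suc: "?p (s - t) y x = (?p (s - Suc t) y (x + 1) + ?p (s - Suc t) y (x - 1)) / 2" if "s \<in> {t<..T}" for s y
  proof -
    have "s - t = Suc (s - Suc t)" using that by auto
    then show ?thesis by (simp add: srw_prob_Suc)
  qed
  have "(\<Sum>s\<in>{t<..T}. \<Sum>y\<in>X s. ?p (s - t) y x * ?Z s y) =
      (\<Sum>s\<in>{t<..T}. \<Sum>y\<in>X s. (?p (s - Suc t) y (x + 1) * ?Z s y + ?p (s - Suc t) y (x - 1) * ?Z s y) / 2)"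
    by (intro sum.cong refl, subst p_Suc) (auto simp: field_simps)
  also have "\<dots> = ((\<Sum>s\<in>{t<..T}. \<Sum>y\<in>X s. ?p (s - Suc t) y (x + 1) * ?Z s y) +
      (\<Sum>s\<in>{t<..T}. \<Sum>y\<in>X s. ?p (s - Suc t) y (x - 1) * ?Z s y)) / 2"
    by (simp only: sum.distrib sum_divide_distrib[symmetric])
  finally have split: "(\<Sum>s\<in>{t<..T}. \<Sum>y\<in>X s. ?p (s - t) y x * ?Z s y) = \<dots>" .
  \<comment> \<open>The time \<open>Suc t\<close> is split off: no free step is left there, and the
    transition probability becomes a delta at \<open>z\<close>.\<close>
  have "{t<..T} = insert (Suc t) {Suc t<..T}"
    using Suc.prems by (auto simp: t_def)
  moreover have "(\<Sum>y\<in>X (Suc t). ?p (Suc t - Suc t) y z * ?Z (Suc t) y) = ?Z (Suc t) z" if "z \<in> X (Suc t)" for z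
  proof -
    have "(\<Sum>y\<in>X (Suc t). ?p (Suc t - Suc t) y z * ?Z (Suc t) y) = (\<Sum>y\<in>X (Suc t). if z = y then ?Z (Suc t) y else 0)"
      by (intro sum.cong) (auto simp: srw_prob_0)
    also have "\<dots> = ?Z (Suc t) z" using that fin by simp
    finally show ?thesis .
  qed
  ultimately have first: "(\<Sum>s\<in>{t<..T}. \<Sum>y\<in>X s. ?p (s - Suc t) y z * ?Z s y) =
      ?Z (Suc t) z + (\<Sum>s\<in>{Suc t<..T}. \<Sum>y\<in>X s. ?p (s - Suc t) y z * ?Z s y)" if "z \<in> X (Suc t)" for z
    using that by simp
  have gz: "g (Suc t) z * backward g T M n z = ?Z (Suc t) z + M (Suc t) z +
      (\<Sum>s\<in>{Suc t<..T}. \<Sum>y\<in>X s. ?p (s - Suc t) y z * ?Z s y)" if "z \<in> X (Suc t)" for z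
    using IH[OF that] unfolding g[of "Suc t" z] by (simp add: algebra_simps t)
  show ?case
    unfolding t(2) split first[OF x(2)] first[OF x(3)]
    by (simp only: backward.simps t(1) gz[OF x(2)] gz[OF x(3)] harmonic[of t x])
      (simp add: field_simps)
qed

lemma det_scale_rows:
  fixes A :: "nat \<Rightarrow> nat \<Rightarrow> 'a::comm_ring_1"
  shows "(\<Prod>i<n. c i) * Determinant.det (Matrix.mat n n (\<lambda>(i, k). A i k)) =
    Determinant.det (Matrix.mat n n (\<lambda>(i, k). c i * A i k))"
proof -
  have "p i < n" if "p permutes {0..<n}" "i < n" for p i
    using permutes_in_image[OF that(1), of i] that(2) by simp
  then show ?thesis
    by (simp add: det_def'[of _ n] sum_distrib_left lessThan_atLeast0 prod.distrib mult_ac)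
qed

text \<open>Row \<open>i\<close> depends on \<open>e\<close> only through \<open>e i\<close>, so
  this is multilinearity in the rows.\<close>

lemma sum_det_rows:
  fixes A :: "nat \<Rightarrow> nat \<Rightarrow> 'b \<Rightarrow> 'a::comm_ring_1"
  assumes "finite B"
  shows "(\<Sum>e\<in>{..<n} \<rightarrow>\<^sub>E B. Determinant.det (Matrix.mat n n (\<lambda>(i, k). A i k (e i)))) =
    Determinant.det (Matrix.mat n n (\<lambda>(i, k). \<Sum>b\<in>B. A i k b))"
proof -
  have perm: "p i < n" if "p permutes {0..<n}" "i < n" for p i
    using permutes_in_image[OF that(1), of i] that(2) by simp
  have "(\<Sum>e\<in>{..<n} \<rightarrow>\<^sub>E B. Determinant.det (Matrix.mat n n (\<lambda>(i, k). A i k (e i)))) =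
      (\<Sum>e\<in>{..<n} \<rightarrow>\<^sub>E B. \<Sum>p | p permutes {0..<n}. signof p * (\<Prod>i<n. A i (p i) (e i)))"
    by (simp add: det_def'[of _ n] perm lessThan_atLeast0)
  also have "\<dots> = (\<Sum>p | p permutes {0..<n}. signof p * (\<Sum>e\<in>{..<n} \<rightarrow>\<^sub>E B. \<Prod>i<n. A i (p i) (e i)))"
    by (subst sum.swap) (simp add: sum_distrib_left)
  also have "\<dots> = (\<Sum>p | p permutes {0..<n}. signof p * (\<Prod>i<n. \<Sum>b\<in>B. A i (p i) b))"
    using assms by (simp add: prod_sum_PiE)
  also have "\<dots> = Determinant.det (Matrix.mat n n (\<lambda>(i, k). \<Sum>b\<in>B. A i k b))"
    by (simp add: det_def'[of _ n] perm lessThan_atLeast0)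
  finally show ?thesis .
qed


subsection \<open>Sums over paths and their determinants\<close>

text \<open>The arrays are \<open>undefined\<close> off the index set, so that the set is finite and
  every path up to time \<open>t\<close> occurs once.\<close>

definition unit_paths :: "nat \<Rightarrow> nat \<Rightarrow> (nat \<times> nat \<Rightarrow> int) set" where
  "unit_paths N t = ({..<N} \<times> {1..t}) \<rightarrow>\<^sub>E {- 1, 1}"

lemma finite_unit_paths [simp]: "finite (unit_paths N t)"
  by (auto simp: unit_paths_def intro!: finite_PiE)

lemma length_walk [simp]: "length (walk u t \<omega>) = length u"
  by (simp add: walk_def)

lemma walk_cong:
  assumes "\<And>j i. j < length u \<Longrightarrow> 1 \<le> i \<Longrightarrow> i \<le> t \<Longrightarrow> \<omega> (j, i) = \<omega>' (j, i)"
  shows "walk u t \<omega> = walk u t \<omega>'"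
  using assms by (auto simp: walk_def intro!: sum.cong)

lemma walk_0 [simp]: "walk u 0 \<omega> = u"
  by (simp add: walk_def map_nth)

lemma walk_Suc_nth: "j < length u \<Longrightarrow> walk u (Suc t) \<omega> ! j = walk u t \<omega> ! j + \<omega> (j, Suc t)"
  by (simp add: walk_def)

definition extend_path :: "nat \<Rightarrow> nat \<Rightarrow> (nat \<times> nat \<Rightarrow> int) \<Rightarrow> (nat \<Rightarrow> int) \<Rightarrow> nat \<times> nat \<Rightarrow> int" where
  "extend_path N t \<omega> e = (\<lambda>(j, i). if i = Suc t \<and> j < N then e j else \<omega> (j, i))"

lemma walk_extend_path: "s \<le> t \<Longrightarrow> walk u s (extend_path (length u) t \<omega> e) = walk u s \<omega>"
  by (rule walk_cong) (auto simp: extend_path_def)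

lemma walk_Suc_extend_path:
  "j < length u \<Longrightarrow> walk u (Suc t) (extend_path (length u) t \<omega> e) ! j = walk u t \<omega> ! j + e j"
  by (simp add: walk_Suc_nth walk_extend_path) (simp add: extend_path_def)

lemma sum_unit_paths_Suc:
  "(\<Sum>\<omega>\<in>unit_paths N (Suc t). f \<omega>) =
    (\<Sum>\<omega>\<in>unit_paths N t. \<Sum>e\<in>{..<N} \<rightarrow>\<^sub>E {- 1, 1}. f (extend_path N t \<omega> e))"
proof -
  let ?r = "\<lambda>\<omega> :: nat \<times> nat \<Rightarrow> int. (restrict \<omega> ({..<N} \<times> {1..t}), \<lambda>j\<in>{..<N}. \<omega> (j, Suc t))"
  have "(\<Sum>\<omega>\<in>unit_paths N (Suc t). f \<omega>) =
      (\<Sum>(\<omega>, e)\<in>unit_paths N t \<times> ({..<N} \<rightarrow>\<^sub>E {- 1, 1}). f (extend_path N t \<omega> e))"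
  proof (rule sum.reindex_bij_witness[where j = ?r and i = "\<lambda>(\<omega>, e). extend_path N t \<omega> e"])
    fix \<omega> assume w: "\<omega> \<in> unit_paths N (Suc t)"
    show eq: "(\<lambda>(\<omega>, e). extend_path N t \<omega> e) (?r \<omega>) = \<omega>"
    proof (rule ext)
      fix p :: "nat \<times> nat"
      show "(\<lambda>(\<omega>, e). extend_path N t \<omega> e) (?r \<omega>) p = \<omega> p"
        using PiE_arb[OF w[unfolded unit_paths_def], of p]
        by (cases p) (auto simp: extend_path_def restrict_def)
    qed
    show "?r \<omega> \<in> unit_paths N t \<times> ({..<N} \<rightarrow>\<^sub>E {- 1, 1})"
      using w by (auto simp: unit_paths_def PiE_iff)
    show "(case ?r \<omega> of (\<omega>, e) \<Rightarrow> f (extend_path N t \<omega> e)) = f \<omega>"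
      using eq by simp
  next
    fix p assume p: "p \<in> unit_paths N t \<times> ({..<N} \<rightarrow>\<^sub>E {- 1, 1 :: int})"
    obtain \<omega> e where [simp]: "p = (\<omega>, e)" by fastforce
    have w: "\<omega> \<in> unit_paths N t" and e: "e \<in> {..<N} \<rightarrow>\<^sub>E {- 1, 1}" using p by auto
    have "restrict (extend_path N t \<omega> e) ({..<N} \<times> {1..t}) q = \<omega> q" for q
      using PiE_arb[OF w[unfolded unit_paths_def], of q]
      by (cases q) (auto simp: extend_path_def restrict_def)
    moreover have "(\<lambda>j\<in>{..<N}. extend_path N t \<omega> e (j, Suc t)) = e"
    proof (rule ext)
      fix j
      show "(\<lambda>j\<in>{..<N}. extend_path N t \<omega> e (j, Suc t)) j = e j"
        using PiE_arb[OF e, of j] by (cases "j < N") (auto simp: extend_path_def)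
    qed
    ultimately show "?r ((\<lambda>(\<omega>, e). extend_path N t \<omega> e) p) = p"
      by (auto simp: fun_eq_iff)
    have "extend_path N t \<omega> e (j, i) \<in> {- 1, 1}" if "j < N" "1 \<le> i" "i \<le> Suc t" for j i
      using w e that by (auto simp: extend_path_def unit_paths_def PiE_iff)
    moreover have "extend_path N t \<omega> e (j, i) = undefined" if "\<not> (j < N \<and> 1 \<le> i \<and> i \<le> Suc t)" for j i
      using PiE_arb[OF w[unfolded unit_paths_def], of "(j, i)"] that by (auto simp: extend_path_def)
    ultimately show "(\<lambda>(\<omega>, e). extend_path N t \<omega> e) p \<in> unit_paths N (Suc t)"
      by (auto simp: unit_paths_def PiE_iff extensional_def)
  qed
  also have "\<dots> = (\<Sum>\<omega>\<in>unit_paths N t. \<Sum>e\<in>{..<N} \<rightarrow>\<^sub>E {- 1, 1}. f (extend_path N t \<omega> e))"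
    by (rule sum.cartesian_product[symmetric])
  finally show ?thesis .
qed

text \<open>The value function of walkers at positions \<open>x\<close> at time \<open>t\<close>.
  For \<open>M = mart u\<close> and \<open>t = T\<close> it becomes the determinant of
  \<open>det_mart\<close>.\<close>

definition backward_det ::
    "(nat \<Rightarrow> int \<Rightarrow> complex) \<Rightarrow> nat \<Rightarrow> (nat \<Rightarrow> nat \<Rightarrow> int \<Rightarrow> complex) \<Rightarrow> nat \<Rightarrow> int list \<Rightarrow> complex" where
  "backward_det g T M t x =
     Determinant.det (Matrix.mat (length x) (length x) (\<lambda>(i, k). backward g T (M k) (T - t) (x ! i)))"

text \<open>Equal positions give equal rows; this makes killing at a collision harmless.\<close>

lemma backward_det_not_distinct:
  assumes "\<not> distinct x"
  shows "backward_det g T M t x = 0"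
proof -
  obtain i j where ij: "i < length x" "j < length x" "i \<noteq> j" "x ! i = x ! j"
    using assms by (auto simp: distinct_conv_nth)
  show ?thesis
    unfolding backward_det_def
    by (rule det_identical_rows[OF _ ij(3,1,2)]) (use ij in \<open>auto intro!: eq_vecI\<close>)
qed

text \<open>One backward step averages each entry over the two neighbours of its position. By
  multilinearity the determinant of the averages is the average over all joint steps.\<close>

lemma backward_det_step:
  assumes "t < T"
  shows "(\<Sum>e\<in>{..<length x} \<rightarrow>\<^sub>E {- 1, 1}. (\<Prod>j<length x. g (Suc t) (x ! j + e j)) *
      backward_det g T M (Suc t) (map (\<lambda>j. x ! j + e j) [0..<length x])) =
    2 ^ length x * backward_det g T M t x"
proof -
  let ?n = "length x"
  have t: "T - t = Suc (T - Suc t)" "T - (T - Suc t) = Suc t" using assms by auto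
  have map: "backward_det g T M (Suc t) (map (\<lambda>j. x ! j + e j) [0..<?n]) =
      Determinant.det (Matrix.mat ?n ?n (\<lambda>(i, k). backward g T (M k) (T - Suc t) (x ! i + e i)))" for e
    unfolding backward_det_def by (auto intro!: arg_cong[where f = Determinant.det] eq_matI)
  have "2 ^ ?n * backward_det g T M t x = (\<Prod>i<?n. 2) * backward_det g T M t x" by simp
  also have "\<dots> = Determinant.det (Matrix.mat ?n ?n (\<lambda>(i, k). 2 * backward g T (M k) (T - t) (x ! i)))"
    unfolding backward_det_def by (rule det_scale_rows)
  also have "\<dots> = Determinant.det (Matrix.mat ?n ?n (\<lambda>(i, k). \<Sum>b\<in>{- 1, 1}.
      g (Suc t) (x ! i + b) * backward g T (M k) (T - Suc t) (x ! i + b)))"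
    by (intro arg_cong[where f = Determinant.det] eq_matI) (auto simp: t)
  finally show ?thesis
    using sum_det_rows[of "{- 1, 1}" ?n "\<lambda>i k b. g (Suc t) (x ! i + b) * backward g T (M k) (T - Suc t) (x ! i + b)"]
    unfolding map det_scale_rows by simp
qed

text \<open>Neighbouring walkers start at an even distance, so they cannot jump over each other: a step
  leaving the chamber produces a coincidence, where the determinant vanishes.\<close>

lemma step_leaves_chamber:
  assumes x: "x \<in> weyl_chamber N" and even: "\<And>i j. i < N \<Longrightarrow> j < N \<Longrightarrow> even (x ! i - x ! j)"
    and e: "e \<in> {..<N} \<rightarrow>\<^sub>E {- 1, 1 :: int}" and y: "y = map (\<lambda>j. x ! j + e j) [0..<N]"
  shows "y \<in> weyl_chamber N \<longleftrightarrow> distinct y"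
proof -
  have "y ! i \<le> y ! j" if "i < j" "j < N" for i j
  proof -
    have "x ! i < x ! j"
      using x that by (auto simp: weyl_chamber_def sorted_wrt_iff_nth_less)
    moreover have "even (x ! j - x ! i)" using even[of j i] that by simp
    ultimately have "x ! i + 2 \<le> x ! j" by presburger
    moreover have "e i \<in> {- 1, 1}" "e j \<in> {- 1, 1}"
      using PiE_mem[OF e, of i] PiE_mem[OF e, of j] that by auto
    then have "e i \<le> 1" "- 1 \<le> e j" by auto
    ultimately show ?thesis using that by (simp add: y)
  qed
  then have "sorted y"
    by (auto simp: sorted_iff_nth_mono_less y)
  then show ?thesis
    by (auto simp: weyl_chamber_def strict_sorted_iff y)
qed

text \<open>The indicator is survival up to time \<open>t\<close>. The product starts at time
  \<open>1\<close>, so the starting point carries no factor.\<close>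

definition path_weight :: "(nat \<Rightarrow> int \<Rightarrow> complex) \<Rightarrow> int list \<Rightarrow> nat \<Rightarrow> (nat \<times> nat \<Rightarrow> int) \<Rightarrow> complex" where
  "path_weight g u t \<omega> = of_bool (\<forall>s\<in>{1..t}. walk u s \<omega> \<in> weyl_chamber (length u)) *
     (\<Prod>s=1..t. \<Prod>j<length u. g s (walk u s \<omega> ! j))"

text \<open>Divided by the number of paths, the left side does not depend on \<open>t\<close>:
  \<open>t = T\<close> gives the killed expectation with its terminal determinant,
  \<open>t = 0\<close> the value at the starting point. The induction step sums out the last joint
  step.\<close>

lemma sum_path_weight:
  assumes u: "u \<in> weyl_chamber N" "\<forall>a\<in>set u. even a" and "t \<le> T"
  shows "(\<Sum>\<omega>\<in>unit_paths N t. path_weight g u t \<omega> * backward_det g T M t (walk u t \<omega>)) =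
    2 ^ (N * t) * backward_det g T M 0 u"
  using assms(3)
proof (induction t)
  case 0
  have "unit_paths N 0 = {\<lambda>_. undefined}" by (simp add: unit_paths_def)
  then show ?case by (simp add: path_weight_def)
next
  case (Suc t)
  have [simp]: "length u = N" using u by (simp add: weyl_chamber_def)
  \<comment> \<open>All walkers start at even sites, so at time \<open>t\<close> they share the
    parity of \<open>t\<close>; hence their distances are even, as
    \<open>step_leaves_chamber\<close> requires.\<close>
  have parity: "even (walk u t \<omega> ! j + int t)" if "\<omega> \<in> unit_paths N t" "j < N" for \<omega> j
  proof -
    have "\<omega> (j, i) \<in> {- 1, 1}" if "i \<in> {1..t}" for i
      using \<open>\<omega> \<in> unit_paths N t\<close> that \<open>j < N\<close> by (auto simp: unit_paths_def PiE_iff)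
    then have "even (\<omega> (j, i) + 1)" if "i \<in> {1..t}" for i
      using that by fastforce
    then have "even (\<Sum>i=1..t. \<omega> (j, i) + 1)"
      by (intro dvd_sum)
    then have "even ((\<Sum>i=1..t. \<omega> (j, i)) + int t)"
      by (simp add: sum.distrib)
    moreover have "even (u ! j)" using u that by (auto simp: weyl_chamber_def)
    ultimately show ?thesis using that by (simp add: walk_def add.assoc)
  qed
  have "(\<Sum>e\<in>{..<N} \<rightarrow>\<^sub>E {- 1, 1}. path_weight g u (Suc t) (extend_path N t \<omega> e) *
        backward_det g T M (Suc t) (walk u (Suc t) (extend_path N t \<omega> e))) =
      2 ^ N * (path_weight g u t \<omega> * backward_det g T M t (walk u t \<omega>))"
    (is "?lhs = _") if \<omega>: "\<omega> \<in> unit_paths N t" for \<omega>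
  proof -
    let ?x = "walk u t \<omega>"
    let ?y = "\<lambda>e. map (\<lambda>j. ?x ! j + e j) [0..<N]"
    have walk_Suc: "walk u (Suc t) (extend_path N t \<omega> e) = ?y e" for e
      using walk_Suc_extend_path[of _ u t \<omega> e] by (intro nth_equalityI) auto
    have walk_le: "walk u s (extend_path N t \<omega> e) = walk u s \<omega>" if "s \<le> t" for s e
      using walk_extend_path[of s t u \<omega> e] that by simp
    have x_in: "?x \<in> weyl_chamber N" if "\<forall>s\<in>{1..t}. walk u s \<omega> \<in> weyl_chamber N"
      using that u by (cases "t = 0") auto
    have weight_Suc: "path_weight g u (Suc t) (extend_path N t \<omega> e) =
        path_weight g u t \<omega> * (of_bool (?y e \<in> weyl_chamber N) * (\<Prod>j<N. g (Suc t) (?x ! j + e j)))" for e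
    proof -
      have "(\<forall>s\<in>{1..Suc t}. walk u s (extend_path N t \<omega> e) \<in> weyl_chamber N) \<longleftrightarrow>
          (\<forall>s\<in>{1..t}. walk u s \<omega> \<in> weyl_chamber N) \<and> ?y e \<in> weyl_chamber N"
        by (auto simp: walk_le walk_Suc atLeastAtMostSuc_conv)
      moreover have "(\<Prod>s=1..t. \<Prod>j<N. g s (walk u s (extend_path N t \<omega> e) ! j)) = (\<Prod>s=1..t. \<Prod>j<N. g s (walk u s \<omega> ! j))"
        by (intro prod.cong) (auto simp: walk_le)
      moreover have "(\<Prod>j<N. g (Suc t) (?y e ! j)) = (\<Prod>j<N. g (Suc t) (?x ! j + e j))"
        by (intro prod.cong) auto
      ultimately show ?thesis
        by (simp add: path_weight_def walk_Suc)
    qed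
    have "?lhs = path_weight g u t \<omega> * (\<Sum>e\<in>{..<N} \<rightarrow>\<^sub>E {- 1, 1}. (\<Prod>j<N. g (Suc t) (?x ! j + e j)) *
        backward_det g T M (Suc t) (?y e))"
    proof (cases "\<forall>s\<in>{1..t}. walk u s \<omega> \<in> weyl_chamber N")
      case True
      have "of_bool (?y e \<in> weyl_chamber N) * backward_det g T M (Suc t) (?y e) = backward_det g T M (Suc t) (?y e)"
        if e: "e \<in> {..<N} \<rightarrow>\<^sub>E {- 1, 1}" for e
      proof -
        have "even (?x ! i - ?x ! j)" if "i < N" "j < N" for i j
          using parity[OF \<omega> that(1)] parity[OF \<omega> that(2)] by presburger
        from step_leaves_chamber[OF x_in[OF True] this e refl] show ?thesis
          by (auto simp: backward_det_not_distinct)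
      qed
      then show ?thesis
        unfolding weight_Suc walk_Suc sum_distrib_left by (intro sum.cong refl) (simp add: mult_ac)
    next
      case False
      then have "path_weight g u t \<omega> = 0" by (simp add: path_weight_def)
      then show ?thesis by (simp add: weight_Suc)
    qed
    also have "(\<Sum>e\<in>{..<N} \<rightarrow>\<^sub>E {- 1, 1}. (\<Prod>j<N. g (Suc t) (?x ! j + e j)) * backward_det g T M (Suc t) (?y e)) =
        2 ^ N * backward_det g T M t ?x"
      using backward_det_step[where t = t and T = T and x = ?x and g = g and M = M] Suc.prems by simp
    finally show ?thesis by (simp add: mult_ac)
  qed
  then have "(\<Sum>\<omega>\<in>unit_paths N (Suc t). path_weight g u (Suc t) \<omega> * backward_det g T M (Suc t) (walk u (Suc t) \<omega>)) =
      2 ^ N * (\<Sum>\<omega>\<in>unit_paths N t. path_weight g u t \<omega> * backward_det g T M t (walk u t \<omega>))"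
    unfolding sum_unit_paths_Suc sum_distrib_left by (intro sum.cong) auto
  then show ?case
    using Suc by (simp add: power_add)
qed


subsection \<open>Integrals over the walks\<close>

abbreviation step_measure :: "int measure" where
  "step_measure \<equiv> measure_pmf (pmf_of_set {- 1, 1})"

lemma prob_space_step_measure: "prob_space step_measure"
  by (rule measure_pmf.prob_space_axioms)

text \<open>A finite product of countable discrete spaces is discrete, so measurability is automatic
  on finitely many coordinates.\<close>

lemma sets_PiM_step_measure:
  assumes "finite I"
  shows "sets (Pi\<^sub>M I (\<lambda>_. step_measure)) = Pow (I \<rightarrow>\<^sub>E UNIV)"
proof -
  have "sets (Pi\<^sub>M I (\<lambda>_. step_measure)) = sets (Pi\<^sub>M I (\<lambda>_. count_space (UNIV :: int set)))"
    by (rule sets_PiM_cong) auto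
  also have "\<dots> = sets (count_space (I \<rightarrow>\<^sub>E (UNIV :: int set)))"
    using assms by (subst count_space_PiM_finite) auto
  finally show ?thesis by simp
qed

text \<open>Each of the \<open>2 ^ card I\<close> sign vectors has the same mass, and almost every
  vector is one of them.\<close>

lemma integral_PiM_steps:
  fixes G :: "('i \<Rightarrow> int) \<Rightarrow> real"
  assumes "finite I"
  shows "(\<integral>\<omega>. G \<omega> \<partial>Pi\<^sub>M I (\<lambda>_. step_measure)) = (\<Sum>\<omega>\<in>I \<rightarrow>\<^sub>E {- 1, 1}. G \<omega>) / 2 ^ card I"
proof -
  let ?P = "Pi\<^sub>M I (\<lambda>_. step_measure)"
  let ?\<Omega> = "I \<rightarrow>\<^sub>E {- 1, 1 :: int}"
  interpret P: prob_space ?P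
    by (intro prob_space_PiM prob_space_step_measure)
  interpret S: product_sigma_finite "\<lambda>_::'i. step_measure"
    by (intro product_sigma_finite.intro prob_space_imp_sigma_finite prob_space_step_measure)
  have fin: "finite ?\<Omega>" using assms by (intro finite_PiE) auto
  have single: "measure ?P {\<omega>} = 1 / 2 ^ card I" if "\<omega> \<in> ?\<Omega>" for \<omega>
  proof -
    have "emeasure ?P (Pi\<^sub>E I (\<lambda>i. {\<omega> i})) = (\<Prod>i\<in>I. emeasure step_measure {\<omega> i})"
      by (rule S.emeasure_PiM) (use assms in auto)
    also have "\<dots> = (\<Prod>i\<in>I. ennreal (1 / 2))"
    proof (intro prod.cong refl)
      fix i assume "i \<in> I"
      then have "\<omega> i \<in> {- 1, 1}" using that by auto
      then show "emeasure step_measure {\<omega> i} = ennreal (1 / 2)"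
        by (auto simp: emeasure_pmf_single pmf_of_set indicator_def)
    qed
    also have "\<dots> = ennreal ((1 / 2) ^ card I)"
      by (simp only: prod_constant ennreal_power)
    also have "Pi\<^sub>E I (\<lambda>i. {\<omega> i}) = {\<omega>}"
      using that by (intro PiE_singleton) (auto simp: PiE_iff)
    finally show ?thesis
      by (simp add: measure_def power_one_over)
  qed
  have sub: "?\<Omega> \<subseteq> I \<rightarrow>\<^sub>E UNIV" by (auto simp: PiE_iff)
  have sets: "{\<omega>} \<in> sets ?P" if "\<omega> \<in> ?\<Omega>" for \<omega>
    using that sub unfolding sets_PiM_step_measure[OF assms] by auto
  have meas: "H \<in> borel_measurable ?P" for H :: "('i \<Rightarrow> int) \<Rightarrow> real"
    using sets_PiM_step_measure[OF assms] by (auto simp: measurable_def space_PiM)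
  have "AE \<omega> in ?P. \<forall>i\<in>I. \<omega> i \<in> {- 1, 1}"
  proof (rule AE_finite_allI[OF assms])
    fix i assume "i \<in> I"
    moreover have "AE x in step_measure. x \<in> {- 1, 1}"
      by (auto simp: AE_measure_pmf_iff)
    ultimately show "AE \<omega> in ?P. \<omega> i \<in> {- 1, 1}"
      by (intro AE_PiM_component prob_space_step_measure)
  qed
  then have "AE \<omega> in ?P. \<omega> \<in> ?\<Omega>"
    using AE_space by eventually_elim (auto simp: PiE_iff space_PiM)
  then have "(\<integral>\<omega>. G \<omega> \<partial>?P) = (\<integral>\<omega>. (\<Sum>\<omega>'\<in>?\<Omega>. G \<omega>' * indicat_real {\<omega>'} \<omega>) \<partial>?P)"
  proof (intro integral_cong_AE meas, elim eventually_mono)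
    fix \<omega> assume "\<omega> \<in> ?\<Omega>"
    have "(\<Sum>\<omega>'\<in>?\<Omega>. G \<omega>' * indicat_real {\<omega>'} \<omega>) = (\<Sum>\<omega>'\<in>?\<Omega>. if \<omega>' = \<omega> then G \<omega> else 0)"
      by (intro sum.cong) (auto simp: indicator_def)
    then show "G \<omega> = (\<Sum>\<omega>'\<in>?\<Omega>. G \<omega>' * indicat_real {\<omega>'} \<omega>)"
      using \<open>\<omega> \<in> ?\<Omega>\<close> fin by simp
  qed
  also have "\<dots> = (\<Sum>\<omega>\<in>?\<Omega>. G \<omega> * measure ?P {\<omega>})"
    using sets by (subst Bochner_Integration.integral_sum) (auto simp: P.emeasure_finite less_top[symmetric] intro!: sum.cong)
  also have "\<dots> = (\<Sum>\<omega>\<in>?\<Omega>. G \<omega>) / 2 ^ card I"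
    by (simp add: single sum_divide_distrib)
  finally show ?thesis .
qed

text \<open>The integrand only sees the steps up to time \<open>T\<close>, so the infinite product
  is projected onto these coordinates, where the integral is a finite average.\<close>

lemma integral_walk_space:
  fixes G :: "(nat \<times> nat \<Rightarrow> int) \<Rightarrow> real"
  assumes "\<And>\<omega> \<omega>'. (\<And>j i. j < N \<Longrightarrow> 1 \<le> i \<Longrightarrow> i \<le> T \<Longrightarrow> \<omega> (j, i) = \<omega>' (j, i)) \<Longrightarrow> G \<omega> = G \<omega>'"
  shows "(\<integral>\<omega>. G \<omega> \<partial>walk_space N) = (\<Sum>\<omega>\<in>unit_paths N T. G \<omega>) / 2 ^ (N * T)"
proof -
  let ?I = "{..<N} \<times> {1..T}"
  let ?P = "Pi\<^sub>M ?I (\<lambda>_. step_measure)"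
  have fin: "finite ?I" by simp
  have meas: "G \<in> borel_measurable ?P"
    using sets_PiM_step_measure[OF fin] by (auto simp: measurable_def space_PiM)
  have restr: "(\<lambda>\<omega>. restrict \<omega> ?I) \<in> measurable (walk_space N) ?P"
    unfolding walk_space_def by (rule measurable_restrict_subset) auto
  have "distr (walk_space N) ?P (\<lambda>\<omega>. \<lambda>n\<in>?I. \<omega> n) = ?P"
    unfolding walk_space_def
    by (rule distr_PiM_reindex[where f = "\<lambda>n. n"]) (auto intro: prob_space_step_measure)
  then have "(\<integral>\<omega>. G \<omega> \<partial>?P) = (\<integral>\<omega>. G \<omega> \<partial>distr (walk_space N) ?P (\<lambda>\<omega>. restrict \<omega> ?I))"
    by simp
  also have "\<dots> = (\<integral>\<omega>. G (restrict \<omega> ?I) \<partial>walk_space N)"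
    by (rule integral_distr[OF restr meas])
  also have "\<dots> = (\<integral>\<omega>. G \<omega> \<partial>walk_space N)"
    by (intro Bochner_Integration.integral_cong refl assms) auto
  finally show ?thesis
    using integral_PiM_steps[OF fin, of G] by (simp add: unit_paths_def)
qed

lemma collision_time_gt_iff:
  "enat T < collision_time u \<omega> \<longleftrightarrow> (\<forall>t\<in>{1..T}. walk u t \<omega> \<in> weyl_chamber (length u))"
proof -
  let ?A = "{enat t |t. t \<ge> 1 \<and> walk u t \<omega> \<notin> weyl_chamber (length u)}"
  show ?thesis
  proof
    assume "enat T < collision_time u \<omega>"
    then have "\<And>x. x \<in> ?A \<Longrightarrow> enat T < x"
      unfolding collision_time_def by (metis (lifting) Inf_lower order.strict_trans2)
    then show "\<forall>t\<in>{1..T}. walk u t \<omega> \<in> weyl_chamber (length u)"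
      by fastforce
  next
    assume *: "\<forall>t\<in>{1..T}. walk u t \<omega> \<in> weyl_chamber (length u)"
    \<comment> \<open>The bound \<open>Suc T\<close> makes the final inequality strict, and it also
      covers the empty set with its infinite infimum.\<close>
    have "enat (Suc T) \<le> Inf ?A"
    proof (rule Inf_greatest)
      fix x assume "x \<in> ?A"
      then show "enat (Suc T) \<le> x"
        using * by (auto simp: not_less_eq_eq)
    qed
    then show "enat T < collision_time u \<omega>"
      unfolding collision_time_def by (rule order.strict_trans2[rotated]) simp
  qed
qed

lemma integral_config_measure: "(\<integral>x. f x \<partial>config_measure X) = (\<Sum>x\<in>#X. f x)" for f :: "int \<Rightarrow> real"
proof -
  have "(\<integral>x. f x \<partial>config_measure X) = (\<integral>x. real (count X x) * f x \<partial>count_space UNIV)"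
    unfolding config_measure_def point_measure_def by (subst integral_density) auto
  also have "\<dots> = (\<Sum>x | x \<in> UNIV \<and> real (count X x) * f x \<noteq> 0. real (count X x) * f x)"
    by (rule lebesgue_integral_count_space_finite_support)
      (auto intro!: finite_subset[OF _ finite_set_mset[of X]] simp: not_in_iff)
  also have "\<dots> = (\<Sum>x\<in>set_mset X. real (count X x) * f x)"
    by (intro sum.mono_neutral_left) (auto simp: not_in_iff)
  also have "\<dots> = (\<Sum>x\<in>#X. f x)"
  proof -
    \<comment> \<open>A fixed finite set \<open>S\<close> containing the support is used, since the
      support itself may grow in the induction.\<close>
    have "(\<Sum>x\<in>S. real (count Y x) * f x) = (\<Sum>x\<in>#Y. f x)" if "finite S" "set_mset Y \<subseteq> S" for S Y
      using that
    proof (induction Y)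
      case empty
      then show ?case by simp
    next
      case (add a Y)
      have "(\<Sum>x\<in>S. real (count (add_mset a Y) x) * f x) = (\<Sum>x\<in>S. real (count Y x) * f x + (if a = x then f x else 0))"
        by (intro sum.cong) (auto simp: algebra_simps)
      then show ?case using add by (simp add: sum.distrib)
    qed
    then show ?thesis by simp
  qed
  finally show ?thesis .
qed

section \<open>From the noncolliding process to finite sums over paths\<close>

lemma noncolliding_walk_integral:
  assumes nc: "noncolliding_walk u P \<Xi>" and T: "T \<ge> 1"
    and F: "bounded (range F)" "depends_up_to T F"
  shows "(\<integral>\<omega>. F (\<lambda>t. \<Xi> t \<omega>) \<partial>P) =
    (\<Sum>\<omega>\<in>unit_paths (length u) T. F (\<lambda>t. mset (walk u t \<omega>)) *
      of_bool (\<forall>t\<in>{1..T}. walk u t \<omega> \<in> weyl_chamber (length u)) *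
      (vandermonde (walk u T \<omega>) / vandermonde u)) / 2 ^ (length u * T)"
proof -
  have "(\<integral>\<omega>. F (\<lambda>t. \<Xi> t \<omega>) \<partial>P) =
      (\<integral>\<omega>. F (\<lambda>t. mset (walk u t \<omega>)) * of_bool (collision_time u \<omega> > enat T) *
         (vandermonde (walk u T \<omega>) / vandermonde u) \<partial>walk_space (length u))"
    using nc T F unfolding noncolliding_walk_def by blast
  also have "\<dots> = (\<integral>\<omega>. F (\<lambda>t. mset (walk u t \<omega>)) *
      of_bool (\<forall>t\<in>{1..T}. walk u t \<omega> \<in> weyl_chamber (length u)) *
      (vandermonde (walk u T \<omega>) / vandermonde u) \<partial>walk_space (length u))"
    unfolding collision_time_gt_iff ..
  also have "\<dots> = (\<Sum>\<omega>\<in>unit_paths (length u) T. F (\<lambda>t. mset (walk u t \<omega>)) *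
      of_bool (\<forall>t\<in>{1..T}. walk u t \<omega> \<in> weyl_chamber (length u)) *
      (vandermonde (walk u T \<omega>) / vandermonde u)) / 2 ^ (length u * T)"
  proof (rule integral_walk_space)
    fix \<omega> \<omega>' :: "nat \<times> nat \<Rightarrow> int"
    assume eq: "\<And>j i. j < length u \<Longrightarrow> 1 \<le> i \<Longrightarrow> i \<le> T \<Longrightarrow> \<omega> (j, i) = \<omega>' (j, i)"
    have walk: "walk u t \<omega> = walk u t \<omega>'" if "t \<le> T" for t
      using that by (intro walk_cong eq) auto
    have "F (\<lambda>t. mset (walk u t \<omega>)) = F (\<lambda>t. mset (walk u t \<omega>'))"
      using F(2) walk unfolding depends_up_to_def by auto
    then show "F (\<lambda>t. mset (walk u t \<omega>)) * of_bool (\<forall>t\<in>{1..T}. walk u t \<omega> \<in> weyl_chamber (length u)) *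
        (vandermonde (walk u T \<omega>) / vandermonde u) =
      F (\<lambda>t. mset (walk u t \<omega>')) * of_bool (\<forall>t\<in>{1..T}. walk u t \<omega>' \<in> weyl_chamber (length u)) *
        (vandermonde (walk u T \<omega>') / vandermonde u)"
      using walk by auto
  qed
  finally show ?thesis .
qed

text \<open>Testing the defining identity with the indicator of a wrong number of points gives
  \<open>0\<close>, because every \<open>walk u t \<omega>\<close> has \<open>length u\<close>
  entries. The exponential functional may be unbounded on all configurations; this allows it to be
  truncated.\<close>

lemma AE_size_noncolliding:
  assumes nc: "noncolliding_walk u P \<Xi>" and "t \<ge> 1"
  shows "AE \<omega> in P. size (\<Xi> t \<omega>) = length u"
proof -
  interpret prob_space P using nc by (simp add: noncolliding_walk_def)
  have [measurable]: "\<Xi> t \<in> measurable P (count_space UNIV)"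
    using nc by (simp add: noncolliding_walk_def)
  let ?F = "\<lambda>X. of_bool (size (X t) \<noteq> length u) :: real"
  have meas: "(\<lambda>\<omega>. ?F (\<lambda>t. \<Xi> t \<omega>)) \<in> borel_measurable P"
    by (rule measurable_compose[of "\<Xi> t" P "count_space UNIV"]) auto
  have "(\<integral>\<omega>. ?F (\<lambda>t. \<Xi> t \<omega>) \<partial>P) = 0"
    by (subst noncolliding_walk_integral[OF nc \<open>t \<ge> 1\<close>])
      (auto simp: depends_up_to_def bounded_iff intro!: exI[of _ 1])
  moreover have "integrable P (\<lambda>\<omega>. ?F (\<lambda>t. \<Xi> t \<omega>))"
    by (rule integrable_const_bound[where B = 1]) (use meas in auto)
  ultimately have "AE \<omega> in P. ?F (\<lambda>t. \<Xi> t \<omega>) = 0"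
    by (subst (asm) integral_nonneg_eq_0_iff_AE) auto
  then show ?thesis by eventually_elim simp
qed

text \<open>By \<open>det_mart\<close> the weight \<open>h(S(T)) / h(u)\<close> is the terminal
  determinant, so the expectation is an average of the form treated in
  \<open>sum_path_weight\<close>.\<close>

lemma noncolliding_exp_functional:
  fixes f :: "nat \<Rightarrow> int \<Rightarrow> real"
  assumes u: "u \<in> weyl_chamber N" "\<forall>a\<in>set u. even a" and nc: "noncolliding_walk u P \<Xi>"
    and ts: "time_points ts" and f: "\<forall>t\<in>set ts. bounded (range (f t))"
    and T: "\<And>t. t \<in> set ts \<Longrightarrow> t \<le> T"
  shows "complex_of_real (\<integral>\<omega>. exp (\<Sum>t\<leftarrow>ts. \<integral>x. f t x \<partial>config_measure (\<Xi> t \<omega>)) \<partial>P) =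
    backward_det (\<lambda>t x. if t \<in> set ts then of_real (exp (f t x)) else 1) T (mart u) 0 u"
proof -
  let ?g = "\<lambda>t x. if t \<in> set ts then complex_of_real (exp (f t x)) else 1"
  have len [simp]: "length u = N" using u by (simp add: weyl_chamber_def)
  interpret prob_space P using nc by (simp add: noncolliding_walk_def)
  have Xi: "\<Xi> t \<in> measurable P (count_space UNIV)" for t
    using nc by (simp add: noncolliding_walk_def)
  have ts': "distinct ts" "\<And>t. t \<in> set ts \<Longrightarrow> 1 \<le> t" "ts \<noteq> []"
    using ts by (auto simp: time_points_def strict_sorted_iff)
  then obtain t0 where "t0 \<in> set ts" by (cases ts) auto
  with T[of t0] ts'(2)[of t0] have "T \<ge> 1" by simp
  define E where "E X = exp (\<Sum>t\<in>set ts. \<Sum>x\<in>#X t. f t x)" for X :: "nat \<Rightarrow> int multiset"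
  \<comment> \<open>Cutting off at the number \<open>N\<close> of points makes the functional
    bounded, so that the defining identity applies; almost surely nothing changes.\<close>
  define F where "F X = E X * of_bool (\<forall>t\<in>set ts. size (X t) = N)" for X
  obtain B where B: "\<bar>f t x\<bar> \<le> B t" if "t \<in> set ts" for t x
  proof -
    from f have "\<forall>t\<in>set ts. \<exists>b. \<forall>x. \<bar>f t x\<bar> \<le> b"
      by (auto simp: bounded_iff)
    then obtain B where "\<forall>t\<in>set ts. \<forall>x. \<bar>f t x\<bar> \<le> B t"
      unfolding bchoice_iff by blast
    then show ?thesis using that by blast
  qed
  have sum_bound: "(\<Sum>x\<in>#A. f t x) \<le> real (size A) * B t" if "t \<in> set ts" for t A
    using B[OF that] by (induction A) (auto simp: algebra_simps abs_le_iff intro: add_mono)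
  have "norm (F X) \<le> exp (\<Sum>t\<in>set ts. real N * B t)" for X
    using sum_bound by (auto simp: F_def E_def intro!: sum_mono)
  then have bounded: "bounded (range F)"
    by (auto simp: bounded_iff)
  have depends: "depends_up_to T F"
    using T by (auto simp: depends_up_to_def F_def E_def intro!: sum.cong)
  have meas_E: "(\<lambda>\<omega>. E (\<lambda>t. \<Xi> t \<omega>)) \<in> borel_measurable P"
    unfolding E_def by (intro borel_measurable_exp[THEN measurable_compose[rotated]] borel_measurable_sum
        measurable_compose[OF Xi]) auto
  have meas_size: "Measurable.pred P (\<lambda>\<omega>. \<forall>t\<in>set ts. size (\<Xi> t \<omega>) = N)"
    by (intro pred_intros_finite measurable_compose[OF Xi, where g = "\<lambda>A. size A = N"]) auto
  have "(\<integral>\<omega>. exp (\<Sum>t\<leftarrow>ts. \<integral>x. f t x \<partial>config_measure (\<Xi> t \<omega>)) \<partial>P) = (\<integral>\<omega>. E (\<lambda>t. \<Xi> t \<omega>) \<partial>P)"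
    by (simp add: E_def integral_config_measure sum_list_distinct_conv_sum_set ts')
  also have "\<dots> = (\<integral>\<omega>. F (\<lambda>t. \<Xi> t \<omega>) \<partial>P)"
  proof (rule integral_cong_AE)
    show "(\<lambda>\<omega>. F (\<lambda>t. \<Xi> t \<omega>)) \<in> borel_measurable P"
      unfolding F_def using meas_E meas_size by measurable
    have "AE \<omega> in P. \<forall>t\<in>set ts. size (\<Xi> t \<omega>) = N"
      using AE_size_noncolliding[OF nc] ts' by (intro AE_finite_allI) auto
    then show "AE \<omega> in P. E (\<lambda>t. \<Xi> t \<omega>) = F (\<lambda>t. \<Xi> t \<omega>)"
      by eventually_elim (simp add: F_def)
  qed (rule meas_E)
  also have "\<dots> = (\<Sum>\<omega>\<in>unit_paths N T. F (\<lambda>t. mset (walk u t \<omega>)) *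
      of_bool (\<forall>t\<in>{1..T}. walk u t \<omega> \<in> weyl_chamber N) *
      (vandermonde (walk u T \<omega>) / vandermonde u)) / 2 ^ (N * T)"
    using noncolliding_walk_integral[OF nc \<open>T \<ge> 1\<close> bounded depends] by simp
  finally have "complex_of_real (\<integral>\<omega>. exp (\<Sum>t\<leftarrow>ts. \<integral>x. f t x \<partial>config_measure (\<Xi> t \<omega>)) \<partial>P) =
      (\<Sum>\<omega>\<in>unit_paths N T. of_real (F (\<lambda>t. mset (walk u t \<omega>))) *
      of_bool (\<forall>t\<in>{1..T}. walk u t \<omega> \<in> weyl_chamber N) *
      of_real (vandermonde (walk u T \<omega>) / vandermonde u)) / 2 ^ (N * T)"
    by (simp add: of_bool_def if_distrib[of complex_of_real] cong: if_cong)
  also have "(\<Sum>\<omega>\<in>unit_paths N T. of_real (F (\<lambda>t. mset (walk u t \<omega>))) *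
      of_bool (\<forall>t\<in>{1..T}. walk u t \<omega> \<in> weyl_chamber N) *
      of_real (vandermonde (walk u T \<omega>) / vandermonde u)) =
    (\<Sum>\<omega>\<in>unit_paths N T. path_weight ?g u T \<omega> * backward_det ?g T (mart u) T (walk u T \<omega>))"
  proof (intro sum.cong refl)
    fix \<omega>
    \<comment> \<open>The factor \<open>?g\<close> is \<open>1\<close> at unobserved times, so only
      the times in \<open>set ts\<close> remain.\<close>
    have "(\<Prod>s=1..T. \<Prod>j<N. ?g s (walk u s \<omega> ! j)) = (\<Prod>s\<in>set ts. \<Prod>j<N. ?g s (walk u s \<omega> ! j))"
      using T ts' by (intro prod.mono_neutral_right) auto
    also have "\<dots> = (\<Prod>s\<in>set ts. of_real (exp (\<Sum>j<N. f s (walk u s \<omega> ! j))))"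
      by (intro prod.cong refl) (simp add: exp_sum)
    also have "\<dots> = (\<Prod>s\<in>set ts. of_real (exp (\<Sum>x\<in>#mset (walk u s \<omega>). f s x)))"
      by (intro prod.cong refl)
        (simp flip: mset_map add: sum_mset_sum_list sum_list_sum_nth lessThan_atLeast0)
    also have "\<dots> = of_real (F (\<lambda>t. mset (walk u t \<omega>)))"
      by (simp add: F_def E_def exp_sum)
    finally have weight: "path_weight ?g u T \<omega> = of_bool (\<forall>t\<in>{1..T}. walk u t \<omega> \<in> weyl_chamber N) *
        of_real (F (\<lambda>t. mset (walk u t \<omega>)))"
      by (simp add: path_weight_def)
    have "backward_det ?g T (mart u) T (walk u T \<omega>) = of_real (vandermonde (walk u T \<omega>) / vandermonde u)"
      using det_mart[OF u(1), of "walk u T \<omega>" T] by (simp add: backward_det_def)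
    then show "of_real (F (\<lambda>t. mset (walk u t \<omega>))) *
        of_bool (\<forall>t\<in>{1..T}. walk u t \<omega> \<in> weyl_chamber N) * of_real (vandermonde (walk u T \<omega>) / vandermonde u) =
        path_weight ?g u T \<omega> * backward_det ?g T (mart u) T (walk u T \<omega>)"
      unfolding weight by simp
  qed
  also have "\<dots> = 2 ^ (N * T) * backward_det ?g T (mart u) 0 u"
    by (rule sum_path_weight[OF u order.refl])
  finally show ?thesis by simp
qed


subsection \<open>The kernel on the space-time light cone\<close>

text \<open>For even starting points these are exactly the sites that the walkers can reach at time
  \<open>t\<close>.\<close>

definition light_cone :: "int list \<Rightarrow> nat \<Rightarrow> int set" where
  "light_cone u t = {x. even (int t + x) \<and> (\<exists>v\<in>set u. \<bar>x - v\<bar> \<le> int t)}"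

lemma finite_light_cone [simp]: "finite (light_cone u t)"
proof (rule finite_subset)
  show "light_cone u t \<subseteq> (\<Union>v\<in>set u. {v - int t..v + int t})"
    by (auto simp: light_cone_def abs_le_iff)
qed auto

lemma light_cone_step: "x \<in> light_cone u t \<Longrightarrow> x + 1 \<in> light_cone u (Suc t) \<and> x - 1 \<in> light_cone u (Suc t)"
  unfolding light_cone_def by (auto elim!: bexI[rotated])

lemma light_cone_srw_prob:
  assumes "srw_prob n y x \<noteq> 0" "x \<in> light_cone u t"
  shows "y \<in> light_cone u (t + n)"
proof -
  from assms(2) obtain v where v: "v \<in> set u" "\<bar>x - v\<bar> \<le> int t" "even (int t + x)"
    by (auto simp: light_cone_def)
  have "\<bar>y - v\<bar> \<le> int (t + n)" 
    using srw_prob_neq_0D(1)[OF assms(1)] v(2) by simp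
  moreover have "even (int (t + n) + y)"
    using srw_prob_neq_0D(2)[OF assms(1)] v(3) by auto
  ultimately show ?thesis using v(1) by (auto simp: light_cone_def)
qed

lemma sum_list_index_eq_sum:
  assumes "distinct ps"
  shows "(\<Sum>i = 0..<length ps. h (ps ! i)) = (\<Sum>p\<in>set ps. h p)"
  by (rule sum.reindex_bij_betw[of "\<lambda>i. ps ! i"]) (use assms in \<open>auto intro!: bij_betw_nth\<close>)

text \<open>On the cone over \<open>S\<close> the expansion reads \<open>U Z = M\<close> with
  \<open>U = 1 - L c\<close>, and at time \<open>0\<close> it says that \<open>1 + C Z\<close> is
  the matrix of the left side. Sylvester's identity passes from the \<open>N\<close> walkers to the
  space-time points.\<close>

lemma backward_det_eq_sdet:
  assumes u: "u \<in> weyl_chamber N" "\<forall>a\<in>set u. even a"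
    and S: "finite S" "\<And>t. t \<in> S \<Longrightarrow> 1 \<le> t \<and> t \<le> T"
    and g: "\<And>t x. g t x = 1 + c t x" and c: "\<And>t x. t \<notin> S \<Longrightarrow> c t x = 0"
  shows "backward_det g T (mart u) 0 u =
    sdet (Sigma S (light_cone u)) (\<lambda>p q. of_bool (p = q) + c (fst p) (snd p) * corr_kernel u p q)"
proof -
  let ?X = "Sigma S (light_cone u)"
  have len [simp]: "length u = N" and "distinct u"
    using u by (auto simp: weyl_chamber_def strict_sorted_iff)
  obtain ps0 where "set ps0 = ?X" "distinct ps0"
    using finite_distinct_list[of ?X] S(1) by auto
  \<comment> \<open>Sorting by time makes \<open>L\<close> strictly upper triangular in this
    enumeration, so that \<open>U\<close> has determinant \<open>1\<close>.\<close>
  then obtain ps where ps: "set ps = ?X" "distinct ps" "sorted (map fst ps)"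
    by (intro that[of "sort_key fst ps0"]) auto
  let ?n = "length ps"
  let ?t = "\<lambda>i. fst (ps ! i)" and ?x = "\<lambda>i. snd (ps ! i)"
  let ?c = "\<lambda>p. c (fst p) (snd p)"
  define Z where "Z k t x = backward g T (mart u k) (T - t) x" for k t x
  define L where "L = (\<lambda>(s, x) (t, y). if s < t then complex_of_real (srw_prob (t - s) y x) else 0)"
  have ps_X: "ps ! i \<in> ?X" if "i < ?n" for i
    using that ps(1) nth_mem by blast
  have ps_in: "?t i \<in> S" "?x i \<in> light_cone u (?t i)" if "i < ?n" for i
    using ps_X[OF that] by auto
  define U where "U = Matrix.mat ?n ?n (\<lambda>(i, j). of_bool (i = j) - L (ps ! i) (ps ! j) * ?c (ps ! j))"
  define Zm where "Zm = Matrix.mat ?n N (\<lambda>(i, k). Z k (?t i) (?x i))"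
  define C where "C = Matrix.mat N ?n (\<lambda>(k, i). of_real (srw_prob (?t i) (?x i) (u ! k)) * ?c (ps ! i))"
  have expand: "Z k t x = mart u k t x + (\<Sum>p\<in>?X. L (t, x) p * ?c p * Z k (fst p) (snd p))"
    if "k < N" "x \<in> light_cone u t" "t \<le> T" for k t x
  proof -
    have "mart u k t x = (mart u k (Suc t) (x + 1) + mart u k (Suc t) (x - 1)) / 2" for t x
      using mart_harmonic[of k u t x] that(1) by simp
    from backward_expansion[where M = "mart u k" and X = "light_cone u" and g = g and c = c and n = "T - t" and T = T and x = x,
        OF this finite_light_cone light_cone_step g] that
    have "Z k t x = mart u k t x + (\<Sum>s\<in>{t<..T}. \<Sum>y\<in>light_cone u s. of_real (srw_prob (s - t) y x) * (c s y * Z k s y))"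
      by (simp add: Z_def)
    \<comment> \<open>Times outside \<open>S\<close> drop out because \<open>c\<close> vanishes
      there, and times of \<open>S\<close> up to \<open>t\<close> contribute nothing because
      \<open>L\<close> vanishes.\<close>
    also have "(\<Sum>s\<in>{t<..T}. \<Sum>y\<in>light_cone u s. of_real (srw_prob (s - t) y x) * (c s y * Z k s y)) =
        (\<Sum>s\<in>S. \<Sum>y\<in>light_cone u s. L (t, x) (s, y) * ?c (s, y) * Z k s y)"
      by (rule sum.mono_neutral_cong) (use S c in \<open>auto simp: L_def mult.assoc intro!: sum.neutral\<close>)
    also have "\<dots> = (\<Sum>p\<in>?X. L (t, x) p * ?c p * Z k (fst p) (snd p))"
      using S(1) by (subst sum.Sigma) (auto intro!: sum.cong)
    finally show ?thesis .
  qed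
  have U: "U \<in> carrier_mat ?n ?n" and Zm: "Zm \<in> carrier_mat ?n N" and C: "C \<in> carrier_mat N ?n"
    by (auto simp: U_def Zm_def C_def)
  have L_0: "L (ps ! i) (ps ! j) = 0" if "j \<le> i" "i < ?n" for i j
    using sorted_nth_mono[OF ps(3), of j i] that by (auto simp: L_def split: prod.splits)
  have "Determinant.det U = prod_list (diag_mat U)"
    by (rule det_upper_triangular[OF _ U]) (auto simp: U_def L_0)
  also have "\<dots> = 1"
    by (auto simp: prod_list_diag_prod U_def L_0 intro!: prod.neutral)
  finally have det_U: "Determinant.det U = 1" .
  have UZ: "U * Zm = Matrix.mat ?n N (\<lambda>(i, k). mart u k (?t i) (?x i))"
  proof (rule eq_matI)
    fix i k assume "i < dim_row (Matrix.mat ?n N (\<lambda>(i, k). mart u k (?t i) (?x i)))"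
      "k < dim_col (Matrix.mat ?n N (\<lambda>(i, k). mart u k (?t i) (?x i)))"
    then have ik: "i < ?n" "k < N" by auto
    have "(U * Zm) $$ (i, k) = (\<Sum>j = 0..<?n. (of_bool (i = j) - L (ps ! i) (ps ! j) * ?c (ps ! j)) * Z k (?t j) (?x j))"
      using ik by (simp add: U_def Zm_def scalar_prod_def)
    also have "\<dots> = (\<Sum>j = 0..<?n. if i = j then Z k (?t j) (?x j) else 0) -
        (\<Sum>j = 0..<?n. L (ps ! i) (ps ! j) * ?c (ps ! j) * Z k (?t j) (?x j))"
      unfolding sum_subtractf[symmetric] by (intro sum.cong) (auto simp: algebra_simps)
    also have "\<dots> = Z k (?t i) (?x i) - (\<Sum>p\<in>?X. L (ps ! i) p * ?c p * Z k (fst p) (snd p))"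
      using ik sum_list_index_eq_sum[OF ps(2), of "\<lambda>p. L (ps ! i) p * ?c p * Z k (fst p) (snd p)"] ps(1) by simp
    also have "\<dots> = mart u k (?t i) (?x i)"
      using expand[OF ik(2) ps_in(2)[OF ik(1)]] S(2)[OF ps_in(1)[OF ik(1)]] by simp
    finally show "(U * Zm) $$ (i, k) = Matrix.mat ?n N (\<lambda>(i, k). mart u k (?t i) (?x i)) $$ (i, k)"
      using ik by simp
  qed (auto simp: U_def Zm_def)
  have CZ: "1\<^sub>m N + C * Zm = Matrix.mat N N (\<lambda>(j, k). Z k 0 (u ! j))"
  proof (rule eq_matI)
    fix j k assume "j < dim_row (Matrix.mat N N (\<lambda>(j, k). Z k 0 (u ! j)))"
      "k < dim_col (Matrix.mat N N (\<lambda>(j, k). Z k 0 (u ! j)))"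
    then have jk: "j < N" "k < N" by auto
    have "u ! j \<in> light_cone u 0" using u(2) jk by (auto simp: light_cone_def)
    then have "Z k 0 (u ! j) = mart u k 0 (u ! j) + (\<Sum>p\<in>?X. L (0, u ! j) p * ?c p * Z k (fst p) (snd p))"
      using expand[OF jk(2)] by simp
    also have "mart u k 0 (u ! j) = of_bool (j = k)"
      using jk by (simp add: mart_0 Phi_node \<open>distinct u\<close>)
    \<comment> \<open>Every time in \<open>S\<close> is at least \<open>1\<close>, so from time
      \<open>0\<close> the strict time ordering in \<open>L\<close> always holds.\<close>
    also have "(\<Sum>p\<in>?X. L (0, u ! j) p * ?c p * Z k (fst p) (snd p)) =
        (\<Sum>p\<in>?X. of_real (srw_prob (fst p) (snd p) (u ! j)) * ?c p * Z k (fst p) (snd p))"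
      using S(2) by (intro sum.cong refl) (fastforce simp: L_def)
    also have "\<dots> = (\<Sum>i = 0..<?n. of_real (srw_prob (?t i) (?x i) (u ! j)) * ?c (ps ! i) * Z k (?t i) (?x i))"
      using sum_list_index_eq_sum[OF ps(2), of "\<lambda>p. of_real (srw_prob (fst p) (snd p) (u ! j)) * ?c p * Z k (fst p) (snd p)"] ps(1)
      by simp
    finally show "(1\<^sub>m N + C * Zm) $$ (j, k) = Matrix.mat N N (\<lambda>(j, k). Z k 0 (u ! j)) $$ (j, k)"
      using jk by (simp add: C_def Zm_def scalar_prod_def)
  qed (auto simp: C_def Zm_def)
  have UZC: "U + U * Zm * C = Matrix.mat ?n ?n (\<lambda>(i, j). of_bool (i = j) + ?c (ps ! j) * corr_kernel u (ps ! j) (ps ! i))"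
    unfolding UZ
  proof (rule eq_matI)
    let ?R = "Matrix.mat ?n ?n (\<lambda>(i, j). of_bool (i = j) + ?c (ps ! j) * corr_kernel u (ps ! j) (ps ! i))"
    fix i j assume "i < dim_row ?R" "j < dim_col ?R"
    then have ij: "i < ?n" "j < ?n" by auto
    have kernel: "corr_kernel u (ps ! j) (ps ! i) =
        (\<Sum>k<N. of_real (srw_prob (?t j) (?x j) (u ! k)) * mart u k (?t i) (?x i)) - L (ps ! i) (ps ! j)"
      using ps_in[OF ij(1)] ps_in[OF ij(2)]
      by (auto simp: corr_kernel_def L_def light_cone_def split: prod.splits)
    then show "(U + Matrix.mat ?n N (\<lambda>(i, k). mart u k (?t i) (?x i)) * C) $$ (i, j) = ?R $$ (i, j)"
      using ij by (simp add: kernel U_def C_def scalar_prod_def lessThan_atLeast0 algebra_simps sum_distrib_left)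
  qed (auto simp: U_def C_def)
  have "backward_det g T (mart u) 0 u = Determinant.det (1\<^sub>m N + C * Zm)"
    unfolding CZ by (simp add: backward_det_def Z_def)
  also have "\<dots> = Determinant.det (U + U * Zm * C)"
    by (rule sylvester_det[OF U Zm C det_U])
  \<comment> \<open>The matrix carries the kernel with exchanged arguments and \<open>c\<close> on
    the columns; transposing puts both in the required order.\<close>
  also have "\<dots> = Determinant.det (transpose_mat (U + U * Zm * C))"
    by (rule det_transpose[symmetric, of _ ?n]) (auto simp: UZC)
  also have "transpose_mat (U + U * Zm * C) =
      Matrix.mat ?n ?n (\<lambda>(i, j). of_bool (ps ! i = ps ! j) + ?c (ps ! i) * corr_kernel u (ps ! i) (ps ! j))"
    unfolding UZC by (rule eq_matI) (auto simp: nth_eq_iff_index_eq[OF ps(2)])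
  also have "Determinant.det \<dots> = sdet ?X (\<lambda>p q. of_bool (p = q) + ?c p * corr_kernel u p q)"
    using det_eq_sdet[OF ps(2), of "\<lambda>p q. of_bool (p = q) + ?c p * corr_kernel u p q"] ps(1) by simp
  finally show ?thesis .
qed


subsection \<open>Correlation functions\<close>

lemma set_space_time_points:
  assumes "length xs = length ts"
  shows "set (space_time_points ts xs) = {(ts ! m, x) |m x. m < length ts \<and> x \<in> set (xs ! m)}"
  using assms by (auto simp: space_time_points_def set_zip)

lemma space_time_points_Cons: "space_time_points (t # ts) (x # xs) = map (Pair t) x @ space_time_points ts xs"
  by (simp add: space_time_points_def)

lemma set_space_time_points_map: "set (space_time_points ts (map h ts)) = Sigma (set ts) (\<lambda>t. set (h t))"
proof (induction ts)
  case Nil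
  then show ?case by (simp add: space_time_points_def)
next
  case (Cons t ts)
  then show ?case by (auto simp: space_time_points_Cons)
qed

lemma distinct_space_time_points:
  assumes "length ts = length xs" "distinct ts" "\<forall>x\<in>set xs. distinct x"
  shows "distinct (space_time_points ts xs)"
  using assms
proof (induction ts xs rule: list_induct2)
  case Nil
  then show ?case by (simp add: space_time_points_def)
next
  case (Cons t ts x xs)
  then show ?case
    by (auto simp: space_time_points_Cons set_space_time_points distinct_map inj_on_def)
qed

lemma weight_eq_prod_list:
  assumes "length ts = length xs"
  shows "weight ts g xs = (\<Prod>p\<leftarrow>space_time_points ts xs. g (fst p) (snd p))"
  using assms
proof (induction ts xs rule: list_induct2)
  case Nil
  then show ?case by (simp add: weight_def space_time_points_def)
next
  case (Cons t ts x xs)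
  have "weight (t # ts) g (x # xs) = (\<Prod>j<length x. g t (x ! j)) * weight ts g xs"
    unfolding weight_def by (simp add: prod.lessThan_Suc_shift del: prod.lessThan_Suc)
  moreover have "(\<Prod>j<length x. g t (x ! j)) = prod_list (map (g t) x)"
    by (simp add: prod.list_conv_set_nth lessThan_atLeast0)
  ultimately show ?case
    using Cons by (simp add: space_time_points_Cons o_def)
qed

section \<open>Families of tuples as finite sets of space-time points\<close>

context
  fixes ts :: "nat list"
  assumes ts: "time_points ts"
begin

lemma distinct_times: "distinct ts"
  using ts by (auto simp: time_points_def strict_sorted_iff)

lemma config_family_points:
  assumes "xs \<in> config_families (length ts)"
  shows "length xs = length ts" "distinct (space_time_points ts xs)"
    and "\<And>m. m < length ts \<Longrightarrow> sorted_wrt (<) (xs ! m)"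
proof -
  show len: "length xs = length ts" and sorted: "\<And>m. m < length ts \<Longrightarrow> sorted_wrt (<) (xs ! m)"
    using assms by (auto simp: config_families_def weyl_chamber_def)
  from sorted have "\<forall>x\<in>set xs. distinct x"
    by (auto simp: in_set_conv_nth len strict_sorted_iff)
  then show "distinct (space_time_points ts xs)"
    using len distinct_times by (intro distinct_space_time_points) auto
qed

lemma weight_eq_prod:
  assumes "xs \<in> config_families (length ts)"
  shows "weight ts g xs = (\<Prod>p\<in>set (space_time_points ts xs). g (fst p) (snd p))"
  using config_family_points[OF assms] by (simp add: weight_eq_prod_list prod.distinct_set_conv_list)

lemma kernel_det_eq_sdet:
  assumes "xs \<in> config_families (length ts)"
  shows "kernel_det K ts xs = sdet (set (space_time_points ts xs)) K"
  using det_eq_sdet[OF config_family_points(2)[OF assms], of K] by (simp add: kernel_det_def Let_def)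

text \<open>A family of increasing tuples is recovered from its set of points by sorting the time
  slices. This turns a sum over principal minors into a sum over families.\<close>

lemma bij_betw_space_time_points:
  assumes "finite X" "fst ` X \<subseteq> set ts"
  shows "bij_betw (\<lambda>xs. set (space_time_points ts xs))
    {xs \<in> config_families (length ts). set (space_time_points ts xs) \<subseteq> X} (Pow X)"
proof (rule bij_betw_byWitness[where f' = "\<lambda>Y. map (\<lambda>t. sorted_list_of_set {x. (t, x) \<in> Y}) ts"])
  have fin: "finite {x. (t, x) \<in> Y}" if "Y \<subseteq> X" for Y t
    by (rule finite_subset[of _ "snd ` X"]) (use that assms(1) in \<open>force\<close>)+
  have points: "set (space_time_points ts (map (\<lambda>t. sorted_list_of_set {x. (t, x) \<in> Y}) ts)) = Y"
    if "Y \<subseteq> X" for Y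
  proof -
    have "t \<in> set ts" if "(t, x) \<in> Y" for t x
      using that \<open>Y \<subseteq> X\<close> assms(2) by force
    then show ?thesis
      unfolding set_space_time_points_map using fin[OF that] by auto
  qed
  then show "\<forall>Y\<in>Pow X. set (space_time_points ts (map (\<lambda>t. sorted_list_of_set {x. (t, x) \<in> Y}) ts)) = Y"
    by blast
  show "(\<lambda>Y. map (\<lambda>t. sorted_list_of_set {x. (t, x) \<in> Y}) ts) ` Pow X
      \<subseteq> {xs \<in> config_families (length ts). set (space_time_points ts xs) \<subseteq> X}"
    using points by (auto simp: config_families_def weyl_chamber_def)
  show "\<forall>xs\<in>{xs \<in> config_families (length ts). set (space_time_points ts xs) \<subseteq> X}.
      map (\<lambda>t. sorted_list_of_set {x. (t, x) \<in> set (space_time_points ts xs)}) ts = xs"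
  proof safe
    fix xs assume xs: "xs \<in> config_families (length ts)"
    note xs' = config_family_points[OF xs]
    show "map (\<lambda>t. sorted_list_of_set {x. (t, x) \<in> set (space_time_points ts xs)}) ts = xs"
    proof (rule nth_equalityI)
      fix m assume "m < length (map (\<lambda>t. sorted_list_of_set {x. (t, x) \<in> set (space_time_points ts xs)}) ts)"
      then have m: "m < length ts" by simp
      have "{x. (ts ! m, x) \<in> set (space_time_points ts xs)} = set (xs ! m)"
        using m nth_eq_iff_index_eq[OF distinct_times] by (auto simp: set_space_time_points[OF xs'(1)])
      then show "map (\<lambda>t. sorted_list_of_set {x. (t, x) \<in> set (space_time_points ts xs)}) ts ! m = xs ! m"
        using m xs'(3)[OF m] by (simp add: strict_sorted_equal sorted_list_of_set.idem_if_sorted_distinct strict_sorted_iff)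
    qed (simp add: xs'(1))
  qed
qed blast

text \<open>Among the points outside the cone take one of earliest time. Its row is
  \<open>0\<close>: it cannot be reached from \<open>u\<close>, nor from earlier points of the
  family, which lie in the cone; for wrong parity the kernel is \<open>0\<close> by
  definition.\<close>

lemma kernel_det_eq_0:
  assumes xs: "xs \<in> config_families (length ts)"
    and out: "\<not> set (space_time_points ts xs) \<subseteq> Sigma (set ts) (light_cone u)"
  shows "kernel_det (corr_kernel u) ts xs = 0"
proof -
  let ?Y = "set (space_time_points ts xs)" and ?X = "Sigma (set ts) (light_cone u)"
  have "fst ` ?Y \<subseteq> set ts"
    using config_family_points(1)[OF xs] by (auto simp: set_space_time_points)
  have "?Y - ?X \<noteq> {}" using out by auto
  then have "Min (fst ` (?Y - ?X)) \<in> fst ` (?Y - ?X)"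
    by (intro Min_in) auto
  then obtain p where p: "p \<in> ?Y - ?X" "fst p = Min (fst ` (?Y - ?X))"
    by (metis imageE)
  then have least: "fst p \<le> fst q" if "q \<in> ?Y - ?X" for q
    using that by simp
  obtain s x where [simp]: "p = (s, x)" by fastforce
  have "corr_kernel u p q = 0" if q: "q \<in> ?Y" for q
  proof (cases "even (int s + x)")
    case False
    then show ?thesis by (simp add: corr_kernel_def split: prod.splits)
  next
    case True
    obtain t y where [simp]: "q = (t, y)" by fastforce
    have x: "x \<notin> light_cone u s"
      using p \<open>fst ` ?Y \<subseteq> set ts\<close> by auto
    then have "srw_prob s x (u ! j) = 0" if "j < length u" for j
      using srw_prob_neq_0D(1)[of s x "u ! j"] that True by (auto simp: light_cone_def)
    moreover have "srw_prob (s - t) x y = 0" if "t < s"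
    proof (rule ccontr)
      assume *: "srw_prob (s - t) x y \<noteq> 0"
      have "q \<in> ?X" using least[of q] q that by force
      then have "x \<in> light_cone u (t + (s - t))"
        by (intro light_cone_srw_prob[OF *]) auto
      then show False using x that by simp
    qed
    ultimately show ?thesis by (simp add: corr_kernel_def)
  qed
  with p show ?thesis
    unfolding kernel_det_eq_sdet[OF xs] by (intro sdet_row_0[of _ p]) auto
qed

text \<open>The weights of \<open>f = ln 2\<close> on the points of \<open>xs\<close> and \<open>0\<close> elsewhere select the subfamilies of
  \<open>xs\<close>.\<close>

lemma config_family_coefficients_unique:
  fixes D :: "int list list \<Rightarrow> complex"
  assumes sum_0: "\<And>f. \<forall>t\<in>set ts. bounded (range (f t)) \<Longrightarrow>
      ((\<lambda>xs. of_real (weight ts (\<lambda>t x. exp (f t x) - 1) xs) * D xs) has_sum 0) (config_families (length ts))"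
    and "xs \<in> config_families (length ts)"
  shows "D xs = 0"
  using assms(2)
\<comment> \<open>Once all proper subfamilies of \<open>xs\<close> have coefficient
  \<open>0\<close>, the vanishing sum over the subfamilies leaves only the coefficient of
  \<open>xs\<close>.\<close>
proof (induction "card (set (space_time_points ts xs))" arbitrary: xs rule: less_induct)
  case less
  let ?p = "\<lambda>xs. set (space_time_points ts xs)"
  let ?A = "config_families (length ts)"
  let ?f = "\<lambda>t x. if (t, x) \<in> ?p xs then ln 2 else 0 :: real"
  let ?S = "{ys \<in> ?A. ?p ys \<subseteq> ?p xs}"
  have bij: "bij_betw ?p ?S (Pow (?p xs))"
    using config_family_points(1)[OF less.prems]
    by (intro bij_betw_space_time_points finite_set) (auto simp: set_space_time_points)
  then have fin: "finite ?S"
    using bij_betw_finite by blast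
  have "\<forall>t\<in>set ts. bounded (range (?f t))"
    by (auto simp: bounded_iff intro!: exI[of _ "ln 2"])
  then have "((\<lambda>ys. of_real (weight ts (\<lambda>t x. exp (?f t x) - 1) ys) * D ys) has_sum 0) ?A"
    by (rule sum_0)
  moreover have weight: "weight ts (\<lambda>t x. exp (?f t x) - 1) ys = of_bool (?p ys \<subseteq> ?p xs)" if "ys \<in> ?A" for ys
  proof -
    have "weight ts (\<lambda>t x. exp (?f t x) - 1) ys = (\<Prod>p\<in>?p ys. of_bool (p \<in> ?p xs))"
      unfolding weight_eq_prod[OF that] by (intro prod.cong) auto
    also have "\<dots> = of_bool (?p ys \<subseteq> ?p xs)"
    proof (cases "?p ys \<subseteq> ?p xs")
      case True
      then show ?thesis by (subst prod.neutral) auto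
    next
      case False
      then show ?thesis by (subst prod_zero) auto
    qed
    finally show ?thesis .
  qed
  ultimately have "((\<lambda>ys. of_bool (?p ys \<subseteq> ?p xs) * D ys) has_sum 0) ?A"
    by (subst (asm) has_sum_cong) (auto simp: weight)
  moreover have "((\<lambda>ys. of_bool (?p ys \<subseteq> ?p xs) * D ys) has_sum (\<Sum>ys\<in>?S. D ys)) ?A"
    using fin by (intro has_sum_finite_neutralI[of ?S]) auto
  ultimately have "0 = (\<Sum>ys\<in>?S. D ys)"
    by (rule has_sum_unique)
  moreover have "D ys = 0" if "ys \<in> ?S" "ys \<noteq> xs" for ys
  proof (rule less.hyps)
    have "?p ys \<noteq> ?p xs"
      using bij that less.prems by (auto simp: bij_betw_def inj_on_def)
    then show "card (?p ys) < card (?p xs)"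
      using that by (intro psubset_card_mono) auto
  qed (use that in auto)
  then have "(\<Sum>ys\<in>?S - {xs}. D ys) = 0"
    by (intro sum.neutral) auto
  ultimately show ?case
    using sum.remove[OF fin, of xs D] less.prems by auto
qed

text \<open>Only families inside the finite cone contribute, so convergence is immediate. The terms
  are the principal minors in the expansion of \<open>det (1 + c K)\<close>.\<close>

lemma fredholm_term_has_sum:
  assumes u: "u \<in> weyl_chamber N" "\<forall>a\<in>set u. even a" and nc: "noncolliding_walk u P \<Xi>"
    and f: "\<forall>t\<in>set ts. bounded (range (f t))"
  shows "(fredholm_term (corr_kernel u) ts (\<lambda>t x. exp (f t x) - 1) has_sum
    complex_of_real (\<integral>\<omega>. exp (\<Sum>t\<leftarrow>ts. \<integral>x. f t x \<partial>config_measure (\<Xi> t \<omega>)) \<partial>P)) (config_families (length ts))"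
proof -
  let ?X = "Sigma (set ts) (light_cone u)"
  let ?p = "\<lambda>xs. set (space_time_points ts xs)"
  let ?S = "{xs \<in> config_families (length ts). ?p xs \<subseteq> ?X}"
  let ?h = "\<lambda>t x. exp (f t x) - 1"
  \<comment> \<open>So \<open>1 + ?c\<close> is \<open>exp f\<close> at observed times and
    \<open>1\<close> elsewhere, the factor used in
    \<open>noncolliding_exp_functional\<close>.\<close>
  let ?c = "\<lambda>t x. if t \<in> set ts then complex_of_real (?h t x) else 0"
  define T where "T = Max (set ts)"
  have T: "t \<le> T" if "t \<in> set ts" for t
    using that by (simp add: T_def)
  have finX: "finite ?X" by simp
  have bij: "bij_betw ?p ?S (Pow ?X)"
    by (rule bij_betw_space_time_points[OF finX]) auto
  have "complex_of_real (\<integral>\<omega>. exp (\<Sum>t\<leftarrow>ts. \<integral>x. f t x \<partial>config_measure (\<Xi> t \<omega>)) \<partial>P) =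
      backward_det (\<lambda>t x. if t \<in> set ts then of_real (exp (f t x)) else 1) T (mart u) 0 u"
    by (rule noncolliding_exp_functional[OF u nc ts f T])
  also have "\<dots> = sdet ?X (\<lambda>p q. of_bool (p = q) + ?c (fst p) (snd p) * corr_kernel u p q)"
    using ts T by (intro backward_det_eq_sdet[OF u]) (auto simp: time_points_def)
  also have "\<dots> = (\<Sum>Y\<in>Pow ?X. (\<Prod>p\<in>Y. ?c (fst p) (snd p)) * sdet Y (corr_kernel u))"
    unfolding sdet_id_plus[OF finX] sdet_scale_rows ..
  also have "\<dots> = (\<Sum>xs\<in>?S. (\<Prod>p\<in>?p xs. ?c (fst p) (snd p)) * sdet (?p xs) (corr_kernel u))"
    by (rule sum.reindex_bij_betw[OF bij, symmetric])
  also have "\<dots> = (\<Sum>xs\<in>?S. fredholm_term (corr_kernel u) ts ?h xs)"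
  proof (intro sum.cong refl)
    fix xs assume "xs \<in> ?S"
    then have xs: "xs \<in> config_families (length ts)" "?p xs \<subseteq> ?X" by auto
    have "(\<Prod>p\<in>?p xs. ?c (fst p) (snd p)) = of_real (weight ts ?h xs)"
      unfolding weight_eq_prod[OF xs(1)] of_real_prod using xs(2) by (intro prod.cong) auto
    then show "(\<Prod>p\<in>?p xs. ?c (fst p) (snd p)) * sdet (?p xs) (corr_kernel u) =
        fredholm_term (corr_kernel u) ts ?h xs"
      by (simp add: fredholm_term_def kernel_det_eq_sdet[OF xs(1)])
  qed
  finally have E: "complex_of_real (\<integral>\<omega>. exp (\<Sum>t\<leftarrow>ts. \<integral>x. f t x \<partial>config_measure (\<Xi> t \<omega>)) \<partial>P) = \<dots>" .
  have "finite ?S" using bij_betw_finite[OF bij] finX by (simp only: finite_Pow_iff)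
  then show ?thesis
    unfolding E by (intro has_sum_finite_neutralI) (auto simp: fredholm_term_def kernel_det_eq_0)
qed

end

theorem theorem3p3:
  fixes N :: nat and u :: "int list"
    and P :: "'a measure" and \<Xi> :: "nat \<Rightarrow> 'a \<Rightarrow> int multiset"
  assumes "N \<ge> 1"
    and "u \<in> weyl_chamber N"
    and "\<forall>a\<in>set u. even a"
    and "noncolliding_walk u P \<Xi>"
  shows "(\<forall>ts f. time_points ts \<and> (\<forall>t\<in>set ts. bounded (range (f t))) \<longrightarrow>
            fredholm_term (corr_kernel u) ts (\<lambda>t x. exp (f t x) - 1)
              summable_on config_families (length ts) \<and>
            complex_of_real
              (\<integral>\<omega>. exp (\<Sum>t\<leftarrow>ts. \<integral>x. f t x \<partial>config_measure (\<Xi> t \<omega>)) \<partial>P) =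
            fredholm_det (corr_kernel u) ts (\<lambda>t x. exp (f t x) - 1)) \<and>
         (\<exists>\<rho>. is_correlation_function P \<Xi> \<rho>) \<and>
         (\<forall>\<rho> ts xs. is_correlation_function P \<Xi> \<rho> \<and> time_points ts \<and>
            length xs = length ts \<and>
            (\<forall>m<length ts. \<exists>n\<le>N. xs ! m \<in> weyl_chamber n) \<longrightarrow>
            complex_of_real (\<rho> ts xs) =
              (if \<forall>m<length ts. \<forall>x\<in>set (xs ! m). even (int (ts ! m) + x)
               then kernel_det (corr_kernel u) ts xs else 0))"
proof (intro conjI allI impI)
  note has_sum = fredholm_term_has_sum[OF _ assms(2-4)]
  fix ts and f :: "nat \<Rightarrow> int \<Rightarrow> real"
  assume "time_points ts \<and> (\<forall>t\<in>set ts. bounded (range (f t)))"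
  then have "(fredholm_term (corr_kernel u) ts (\<lambda>t x. exp (f t x) - 1) has_sum
    complex_of_real (\<integral>\<omega>. exp (\<Sum>t\<leftarrow>ts. \<integral>x. f t x \<partial>config_measure (\<Xi> t \<omega>)) \<partial>P)) (config_families (length ts))"
    using has_sum by blast
  then show "fredholm_term (corr_kernel u) ts (\<lambda>t x. exp (f t x) - 1) summable_on config_families (length ts)"
    and "complex_of_real (\<integral>\<omega>. exp (\<Sum>t\<leftarrow>ts. \<integral>x. f t x \<partial>config_measure (\<Xi> t \<omega>)) \<partial>P) =
      fredholm_det (corr_kernel u) ts (\<lambda>t x. exp (f t x) - 1)"
    by (auto simp: fredholm_det_def has_sum_imp_summable infsumI)
next
  \<comment> \<open>Correlation functions are real while the kernel has complex type. Weights and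
    expectation are real, so real parts of the expansion provide a witness.\<close>
  have "is_correlation_function P \<Xi> (\<lambda>ts xs. Re (kernel_det (corr_kernel u) ts xs))"
    unfolding is_correlation_function_def
  proof (intro allI impI, elim conjE)
    fix ts and f :: "nat \<Rightarrow> int \<Rightarrow> real"
    assume "time_points ts" "\<forall>t\<in>set ts. bounded (range (f t))"
    from has_sum_Re[OF fredholm_term_has_sum[OF this(1) assms(2-4) this(2)]]
    show "((\<lambda>xs. weight ts (\<lambda>t x. exp (f t x) - 1) xs * Re (kernel_det (corr_kernel u) ts xs)) has_sum
      (\<integral>\<omega>. exp (\<Sum>t\<leftarrow>ts. \<integral>x. f t x \<partial>config_measure (\<Xi> t \<omega>)) \<partial>P)) (config_families (length ts))"
      by (simp add: fredholm_term_def)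
  qed
  then show "\<exists>\<rho>. is_correlation_function P \<Xi> \<rho>"
    by (rule exI[where x = "\<lambda>ts xs. Re (kernel_det (corr_kernel u) ts xs)"])
next
  fix \<rho> ts and xs :: "int list list"
  assume *: "is_correlation_function P \<Xi> \<rho> \<and> time_points ts \<and> length xs = length ts \<and>
    (\<forall>m<length ts. \<exists>n\<le>N. xs ! m \<in> weyl_chamber n)"
  then have ts: "time_points ts" and xs: "xs \<in> config_families (length ts)"
    by (auto simp: config_families_def)
  \<comment> \<open>Both coefficient families expand the same functional, so uniqueness applies to
    their difference.\<close>
  have "of_real (\<rho> ts xs) - kernel_det (corr_kernel u) ts xs = 0"
  proof (rule config_family_coefficients_unique[OF ts _ xs])
    fix f :: "nat \<Rightarrow> int \<Rightarrow> real" assume f: "\<forall>t\<in>set ts. bounded (range (f t))"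
    have "((\<lambda>xs. weight ts (\<lambda>t x. exp (f t x) - 1) xs * \<rho> ts xs) has_sum
          (\<integral>\<omega>. exp (\<Sum>t\<leftarrow>ts. \<integral>x. f t x \<partial>config_measure (\<Xi> t \<omega>)) \<partial>P)) (config_families (length ts))"
      using * f unfolding is_correlation_function_def by blast
    from has_sum_add[OF has_sum_of_real[OF this] has_sum_uminusI[OF fredholm_term_has_sum[OF ts assms(2-4) f]]]
    show "((\<lambda>xs. complex_of_real (weight ts (\<lambda>t x. exp (f t x) - 1) xs) *
        (of_real (\<rho> ts xs) - kernel_det (corr_kernel u) ts xs)) has_sum 0) (config_families (length ts))"
      by (simp add: fredholm_term_def algebra_simps)
  qed
  \<comment> \<open>A point of the wrong parity lies outside the cone.\<close>
  moreover have "kernel_det (corr_kernel u) ts xs = 0"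
    if "\<not> (\<forall>m<length ts. \<forall>x\<in>set (xs ! m). even (int (ts ! m) + x))"
    using that config_family_points(1)[OF ts xs]
    by (intro kernel_det_eq_0[OF ts xs]) (fastforce simp: set_space_time_points light_cone_def)
  ultimately show "complex_of_real (\<rho> ts xs) =
      (if \<forall>m<length ts. \<forall>x\<in>set (xs ! m). even (int (ts ! m) + x)
       then kernel_det (corr_kernel u) ts xs else 0)"
    by auto
qed

end
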